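(* Let $\varphi_p: A_S\to A_{S'}$ be an LCM-homomorphism. Then $\varphi_p$ induces an injective homomorphism $\varphi_{p,W}: W_S\to W_{S'}$ between the associated Coxeter groups.
   Context: Artin-Tits systems. Let $S$ be a finite set and $M=(m_{s,t})_{s,t\in S}$ a symmetric matrix with entries in $(\mathbb{N}\setminus\{0\})\cup\{\infty\}$, with $m_{s,s}=1$ and $m_{s,t}\neq 1$ for $s\ne t$. For elements $u,v$ and $m\in\mathbb{N}$ put $[u,v\rangle^m=\underbrace{uvu\cdots}_{m\text{ terms}}$. The Artin-Tits group is $A_S=\langle S\mid [s,t\rangle^{m_{s,t}}=[t,s\rangle^{m_{s,t}},\ s\neq t\in S,\ m_{s,t}\neq\infty\rangle$; the pair $(A_S,S)$ is called an Artin-Tits system. $A_S^+$ is the submonoid of $A_S$ generated by $S$ (it has the same presentation, as a monoid). The Coxeter group $W_S$ is obtained from the presentation of $A_S$ by adding the relations $s^2=1$, $s\in S$; let $i_S:A_S\to W_S$ be the canonical surjection. "$\varphi_p$ induces $\varphi_{p,W}$" means $\varphi_{p,W}\circ i_S=i_{S'}\circ\varphi_p$. For $T\subset S$, $A_T$ is the subgroup generated by $T$; $(A_T,T)$ is the Artin-Tits system of the matrix $(m_{s,t})_{s,t\in T}$. $T$ (or $A_T$) is of spherical type if $W_T$ is finite. For $u,v\in A_S^+$, $u\prec v$ means that $u$ divides $v$ on the left in $A_S^+$; $u\vee_\prec v$ denotes the least common multiple of $u,v$ for $\prec$ (it is $\infty$ if it does not exist). If $T\subset S$ is of spherical type, $\Delta_T\in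 A_S^+$ denotes the least common multiple of $T$ for $\prec$. LCM-homomorphism. Let $p$ be a map from $S$ to the set of nonempty subsets of $S'$ such that: (L0) if $s\neq t\in S$, then $p(s)\cap p(t)=\emptyset$; (L1) for $s\in S$, $p(s)$ is of spherical type; (L2) if $s\neq t\in S$ and $m_{s,t}\neq\infty$, then $[\Delta_{p(s)},\Delta_{p(t)}\rangle^{m_{s,t}}=[\Delta_{p(t)},\Delta_{p(s)}\rangle^{m_{s,t}}=\Delta_{p(s)}\vee_\prec\Delta_{p(t)}$ in $A_{S'}^+$; (L3) if $s\neq t\in S$ and $m_{s,t}=\infty$, then for every $u\in p(s)$ the set $\{u\}\cup p(t)$ is not of spherical type, and for every $u\in p(t)$ the set $\{u\}\cup p(s)$ is not of spherical type. Then $\varphi_p(s)=\Delta_{p(s)}$ ($s\in S$) defines a homomorphism $\varphi_p:A_S\to A_{S'}$; a homomorphism obtained in this way is called an LCM-homomorphism. *)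

theory Defs
  imports "HOL-Algebra.Divisibility" "HOL-Library.Extended_Nat"
begin

section \<open>Group presentations\<close>

text \<open>A letter \<open>(s, True)\<close> stands for the generator \<open>s\<close>, and \<open>(s, False)\<close> for its formal inverse.\<close>

type_synonym 'a word = "('a \<times> bool) list"

abbreviation words :: "'a set \<Rightarrow> 'a word set" where
  "words S \<equiv> lists (S \<times> UNIV)"

inductive pres_cong :: "'a set \<Rightarrow> ('a word \<times> 'a word) set \<Rightarrow> 'a word \<Rightarrow> 'a word \<Rightarrow> bool"
  for S :: "'a set" and R :: "('a word \<times> 'a word) set" where
  refl: "x \<in> words S \<Longrightarrow> pres_cong S R x x"
| sym: "pres_cong S R x y \<Longrightarrow> pres_cong S R y x"
| trans: "pres_cong S R x y \<Longrightarrow> pres_cong S R y z \<Longrightarrow> pres_cong S R x z"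
| append: "pres_cong S R x y \<Longrightarrow> pres_cong S R x' y' \<Longrightarrow> pres_cong S R (x @ x') (y @ y')"
| cancel: "s \<in> S \<Longrightarrow> pres_cong S R [(s, b), (s, \<not> b)] []"
| rel: "(x, y) \<in> R \<Longrightarrow> x \<in> words S \<Longrightarrow> y \<in> words S \<Longrightarrow> pres_cong S R x y"

definition pres_rel :: "'a set \<Rightarrow> ('a word \<times> 'a word) set \<Rightarrow> ('a word \<times> 'a word) set" where
  "pres_rel S R = {(x, y). pres_cong S R x y}"

definition presented_group :: "'a set \<Rightarrow> ('a word \<times> 'a word) set \<Rightarrow> 'a word set monoid" where
  "presented_group S R =
     \<lparr>carrier = words S // pres_rel S R,
      mult = (\<lambda>X Y. \<Union>x\<in>X. \<Union>y\<in>Y. pres_rel S R `` {x @ y}),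
      one = pres_rel S R `` {[]}\<rparr>"

lemma pres_cong_words:
  "pres_cong S R x y \<Longrightarrow> x \<in> words S \<and> y \<in> words S"
  by (induction rule: pres_cong.induct) auto

lemma equiv_pres_rel: "equiv (words S) (pres_rel S R)"
proof (rule equivI)
  show "pres_rel S R \<subseteq> words S \<times> words S"
    using pres_cong_words by (fastforce simp: pres_rel_def)
  show "refl_on (words S) (pres_rel S R)"
    by (auto simp: refl_on_def pres_rel_def intro: pres_cong.refl)
  show "sym (pres_rel S R)"
    by (rule symI) (simp add: pres_rel_def pres_cong.sym)
  show "trans (pres_rel S R)"
    by (rule transI) (simp add: pres_rel_def pres_cong.trans[of S R])
qed

lemma pres_class_eq_iff:
  assumes "x \<in> words S" "y \<in> words S"
  shows "pres_rel S R `` {x} = pres_rel S R `` {y} \<longleftrightarrow> pres_cong S R x y"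
  using eq_equiv_class_iff[OF equiv_pres_rel assms] by (simp add: pres_rel_def)

lemma pres_mult_class:
  assumes "x \<in> words S" "y \<in> words S"
  shows "(pres_rel S R `` {x}) \<otimes>\<^bsub>presented_group S R\<^esub> (pres_rel S R `` {y})
           = pres_rel S R `` {x @ y}"
proof -
  have "pres_rel S R `` {x' @ y'} = pres_rel S R `` {x @ y}"
    if "pres_cong S R x x'" "pres_cong S R y y'" for x' y'
    using pres_cong.sym[OF pres_cong.append[OF that]] pres_cong_words[OF that(1)]
      pres_cong_words[OF that(2)] assms
    by (subst pres_class_eq_iff) auto
  then have "(\<Union>x'\<in>pres_rel S R `` {x}. \<Union>y'\<in>pres_rel S R `` {y}. pres_rel S R `` {x' @ y'})
      = (\<Union>x'\<in>pres_rel S R `` {x}. \<Union>y'\<in>pres_rel S R `` {y}. pres_rel S R `` {x @ y})"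
    by (intro SUP_cong) (simp_all add: pres_rel_def)
  moreover have "x \<in> pres_rel S R `` {x}" "y \<in> pres_rel S R `` {y}"
    using assms pres_cong.refl by (auto simp: pres_rel_def)
  ultimately show ?thesis
    unfolding presented_group_def by auto
qed

lemma pres_class_in_carrier:
  "x \<in> words S \<Longrightarrow> pres_rel S R `` {x} \<in> carrier (presented_group S R)"
  by (simp add: presented_group_def quotientI)

lemma pres_carrierE:
  assumes "X \<in> carrier (presented_group S R)"
  obtains x where "x \<in> words S" "X = pres_rel S R `` {x}"
  using assms unfolding presented_group_def by (simp add: quotient_def del: in_lists_conv_set) blast

lemma pres_one: "\<one>\<^bsub>presented_group S R\<^esub> = pres_rel S R `` {[]}"
  by (simp add: presented_group_def)

lemma pres_cong_inverse:
  "x \<in> words S \<Longrightarrow> pres_cong S R (rev (map (\<lambda>(s, b). (s, \<not> b)) x) @ x) []"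
proof (induction x)
  case Nil
  then show ?case by (simp add: pres_cong.refl)
next
  case (Cons a x)
  obtain s b where a: "a = (s, b)" by force
  let ?x' = "rev (map (\<lambda>(s, b). (s, \<not> b)) x)"
  have s: "s \<in> S" and x: "x \<in> words S" using Cons.prems a by auto
  have x': "?x' \<in> words S" using x by (auto simp: in_lists_conv_set)
  have "pres_cong S R ([(s, \<not> b), (s, b)] @ x) ([] @ x)"
    using pres_cong.append[OF pres_cong.cancel[OF s, of R "\<not> b"] pres_cong.refl[OF x]] by simp
  then have "pres_cong S R (?x' @ ([(s, \<not> b), (s, b)] @ x)) (?x' @ ([] @ x))"
    by (rule pres_cong.append[OF pres_cong.refl[OF x']])
  then show ?case
    using pres_cong.trans[OF _ Cons.IH[OF x]] a by simp
qed

lemma group_presented_group: "group (presented_group S R)"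
proof (rule groupI)
  fix X Y Z
  assume "X \<in> carrier (presented_group S R)" "Y \<in> carrier (presented_group S R)"
  then show "X \<otimes>\<^bsub>presented_group S R\<^esub> Y \<in> carrier (presented_group S R)"
    by (elim pres_carrierE) (simp add: pres_mult_class pres_class_in_carrier)
  assume "Z \<in> carrier (presented_group S R)"
  with \<open>X \<in> _\<close> \<open>Y \<in> _\<close>
  show "X \<otimes>\<^bsub>presented_group S R\<^esub> Y \<otimes>\<^bsub>presented_group S R\<^esub> Z
      = X \<otimes>\<^bsub>presented_group S R\<^esub> (Y \<otimes>\<^bsub>presented_group S R\<^esub> Z)"
    by (elim pres_carrierE) (simp add: pres_mult_class)
next
  show "\<one>\<^bsub>presented_group S R\<^esub> \<in> carrier (presented_group S R)"
    by (simp add: pres_one pres_class_in_carrier)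
next
  fix X assume X: "X \<in> carrier (presented_group S R)"
  then obtain x where x: "x \<in> words S" "X = pres_rel S R `` {x}" by (rule pres_carrierE)
  show "\<one>\<^bsub>presented_group S R\<^esub> \<otimes>\<^bsub>presented_group S R\<^esub> X = X"
    using x by (simp add: pres_one pres_mult_class)
  let ?x' = "rev (map (\<lambda>(s, b). (s, \<not> b)) x)"
  have x': "?x' \<in> words S" using x(1) by (auto simp: in_lists_conv_set)
  have "pres_rel S R `` {?x'} \<otimes>\<^bsub>presented_group S R\<^esub> X = \<one>\<^bsub>presented_group S R\<^esub>"
    using x x' pres_cong_inverse[OF x(1), of R]
    by (simp add: pres_one pres_mult_class pres_class_eq_iff)
  then show "\<exists>Y\<in>carrier (presented_group S R).
      Y \<otimes>\<^bsub>presented_group S R\<^esub> X = \<one>\<^bsub>presented_group S R\<^esub>"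
    using pres_class_in_carrier[OF x'] by blast
qed

section \<open>Artin-Tits groups and Coxeter groups\<close>

text \<open>A matrix is a function into \<^typ>\<open>enat\<close>; only its values on \<open>S \<times> S\<close> matter.\<close>

definition coxeter_matrix :: "'a set \<Rightarrow> ('a \<Rightarrow> 'a \<Rightarrow> enat) \<Rightarrow> bool" where
  "coxeter_matrix S m \<longleftrightarrow>
     (\<forall>s\<in>S. \<forall>t\<in>S. m s t \<noteq> 0 \<and> m s t = m t s \<and> (m s t = 1 \<longleftrightarrow> s = t))"

definition alternating :: "'a \<Rightarrow> 'a \<Rightarrow> nat \<Rightarrow> 'a list" where
  "alternating u v n = map (\<lambda>i. if even i then u else v) [0..<n]"

definition alternating_prod :: "('a, 'b) monoid_scheme \<Rightarrow> 'a \<Rightarrow> 'a \<Rightarrow> nat \<Rightarrow> 'a" where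
  "alternating_prod G u v n = foldr (\<otimes>\<^bsub>G\<^esub>) (alternating u v n) \<one>\<^bsub>G\<^esub>"

definition artin_relations :: "'a set \<Rightarrow> ('a \<Rightarrow> 'a \<Rightarrow> enat) \<Rightarrow> ('a word \<times> 'a word) set" where
  "artin_relations S m =
     {(alternating (s, True) (t, True) k, alternating (t, True) (s, True) k) | s t k.
        s \<in> S \<and> t \<in> S \<and> s \<noteq> t \<and> m s t = enat k}"

definition coxeter_relations :: "'a set \<Rightarrow> ('a \<Rightarrow> 'a \<Rightarrow> enat) \<Rightarrow> ('a word \<times> 'a word) set" where
  "coxeter_relations S m = artin_relations S m \<union> {([(s, True), (s, True)], []) | s. s \<in> S}"

definition artin_group :: "'a set \<Rightarrow> ('a \<Rightarrow> 'a \<Rightarrow> enat) \<Rightarrow> 'a word set monoid" where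
  "artin_group S m = presented_group S (artin_relations S m)"

definition coxeter_group :: "'a set \<Rightarrow> ('a \<Rightarrow> 'a \<Rightarrow> enat) \<Rightarrow> 'a word set monoid" where
  "coxeter_group S m = presented_group S (coxeter_relations S m)"

definition artin_gen :: "'a set \<Rightarrow> ('a \<Rightarrow> 'a \<Rightarrow> enat) \<Rightarrow> 'a \<Rightarrow> 'a word set" where
  "artin_gen S m s = pres_rel S (artin_relations S m) `` {[(s, True)]}"

text \<open>The canonical surjection \<open>i\<^sub>S\<close>, sending the class of a word in the Artin-Tits group to the
  class of the same word in the Coxeter group.\<close>

definition canonical_surj :: "'a set \<Rightarrow> ('a \<Rightarrow> 'a \<Rightarrow> enat) \<Rightarrow> 'a word set \<Rightarrow> 'a word set" where
  "canonical_surj S m X = (\<Union>x\<in>X. pres_rel S (coxeter_relations S m) `` {x})"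

definition spherical :: "('a \<Rightarrow> 'a \<Rightarrow> enat) \<Rightarrow> 'a set \<Rightarrow> bool" where
  "spherical m T \<longleftrightarrow> finite (carrier (coxeter_group T m))"

lemma group_artin_group: "group (artin_group S m)"
  by (simp add: artin_group_def group_presented_group)

lemma group_coxeter_group: "group (coxeter_group S m)"
  by (simp add: coxeter_group_def group_presented_group)

lemma pres_cong_mono:
  assumes "pres_cong S R x y" "R \<subseteq> R'"
  shows "pres_cong S R' x y"
  using assms(1)
proof induction
  case (refl x)
  then show ?case by (rule pres_cong.refl)
next
  case (sym x y)
  show ?case by (rule pres_cong.sym[OF sym.IH])
next
  case (trans x y z)
  show ?case by (rule pres_cong.trans[OF trans.IH])
next
  case (append x y x' y')
  show ?case by (rule pres_cong.append[OF append.IH])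
next
  case (cancel s b)
  then show ?case by (rule pres_cong.cancel)
next
  case (rel x y)
  then show ?case using assms(2) by (intro pres_cong.rel) auto
qed

lemma canonical_surj_class:
  assumes "x \<in> words S"
  shows "canonical_surj S m (pres_rel S (artin_relations S m) `` {x})
           = pres_rel S (coxeter_relations S m) `` {x}"
proof -
  have "pres_rel S (coxeter_relations S m) `` {y} = pres_rel S (coxeter_relations S m) `` {x}"
    if "pres_cong S (artin_relations S m) x y" for y
    using assms pres_cong_words[OF that] pres_cong.sym[OF pres_cong_mono[OF that]]
    by (subst pres_class_eq_iff) (auto simp: coxeter_relations_def)
  then have "(\<Union>y\<in>pres_rel S (artin_relations S m) `` {x}. pres_rel S (coxeter_relations S m) `` {y})
      = (\<Union>y\<in>pres_rel S (artin_relations S m) `` {x}. pres_rel S (coxeter_relations S m) `` {x})"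
    by (intro SUP_cong) (simp_all add: pres_rel_def)
  moreover have "x \<in> pres_rel S (artin_relations S m) `` {x}"
    using assms pres_cong.refl by (auto simp: pres_rel_def)
  ultimately show ?thesis
    unfolding canonical_surj_def by auto
qed

lemma canonical_surj_hom: "canonical_surj S m \<in> hom (artin_group S m) (coxeter_group S m)"
  unfolding artin_group_def coxeter_group_def
proof (rule homI)
  fix X Y
  assume X: "X \<in> carrier (presented_group S (artin_relations S m))"
  then show "canonical_surj S m X \<in> carrier (presented_group S (coxeter_relations S m))"
    by (elim pres_carrierE)
      (simp add: canonical_surj_class pres_class_in_carrier del: in_lists_conv_set)
  assume "Y \<in> carrier (presented_group S (artin_relations S m))"
  with X show "canonical_surj S m (X \<otimes>\<^bsub>presented_group S (artin_relations S m)\<^esub> Y)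
      = canonical_surj S m X \<otimes>\<^bsub>presented_group S (coxeter_relations S m)\<^esub> canonical_surj S m Y"
    by (elim pres_carrierE)
      (simp add: canonical_surj_class pres_mult_class del: in_lists_conv_set)
qed

lemma canonical_surj_surj:
  "canonical_surj S m ` carrier (artin_group S m) = carrier (coxeter_group S m)"
proof
  show "canonical_surj S m ` carrier (artin_group S m) \<subseteq> carrier (coxeter_group S m)"
    using canonical_surj_hom by (auto simp: hom_def)
  show "carrier (coxeter_group S m) \<subseteq> canonical_surj S m ` carrier (artin_group S m)"
  proof
    fix X assume "X \<in> carrier (coxeter_group S m)"
    then obtain x where x: "x \<in> words S" "X = pres_rel S (coxeter_relations S m) `` {x}"
      unfolding coxeter_group_def by (rule pres_carrierE)
    then have "X = canonical_surj S m (pres_rel S (artin_relations S m) `` {x})"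
      by (simp add: canonical_surj_class)
    then show "X \<in> canonical_surj S m ` carrier (artin_group S m)"
      unfolding artin_group_def using pres_class_in_carrier[OF x(1)] by blast
  qed
qed

section \<open>The positive monoid and least common multiples\<close>

definition artin_monoid :: "'a set \<Rightarrow> ('a \<Rightarrow> 'a \<Rightarrow> enat) \<Rightarrow> 'a word set monoid" where
  "artin_monoid S m =
     (artin_group S m)\<lparr>carrier := (\<lambda>H. submonoid H (artin_group S m)) hull (artin_gen S m ` S)\<rparr>"

text \<open>In a non-commutative monoid, the relation \<open>divides\<close> of \<open>HOL-Algebra\<close> is divisibility on
  the left.\<close>

definition is_left_lcm :: "('a, 'b) monoid_scheme \<Rightarrow> 'a set \<Rightarrow> 'a \<Rightarrow> bool" where
  "is_left_lcm M X d \<longleftrightarrow>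
     d \<in> carrier M \<and> (\<forall>x\<in>X. x divides\<^bsub>M\<^esub> d) \<and>
     (\<forall>y\<in>carrier M. (\<forall>x\<in>X. x divides\<^bsub>M\<^esub> y) \<longrightarrow> d divides\<^bsub>M\<^esub> y)"

text \<open>The value \<open>None\<close> plays the role of \<open>\<infinity>\<close>.\<close>

definition left_lcm :: "('a, 'b) monoid_scheme \<Rightarrow> 'a set \<Rightarrow> 'a option" where
  "left_lcm M X =
     (if \<exists>!d. is_left_lcm M X d then Some (THE d. is_left_lcm M X d) else None)"

definition Delta :: "'a set \<Rightarrow> ('a \<Rightarrow> 'a \<Rightarrow> enat) \<Rightarrow> 'a set \<Rightarrow> 'a word set option" where
  "Delta S m T = left_lcm (artin_monoid S m) (artin_gen S m ` T)"

section \<open>LCM-homomorphisms\<close>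

definition lcm_condition ::
  "'a set \<Rightarrow> ('a \<Rightarrow> 'a \<Rightarrow> enat) \<Rightarrow> 'b set \<Rightarrow> ('b \<Rightarrow> 'b \<Rightarrow> enat) \<Rightarrow> ('a \<Rightarrow> 'b set) \<Rightarrow> bool" where
  "lcm_condition S m S' m' p \<longleftrightarrow>
     (\<forall>s\<in>S. p s \<noteq> {} \<and> p s \<subseteq> S') \<and>
     (\<forall>s\<in>S. \<forall>t\<in>S. s \<noteq> t \<longrightarrow> p s \<inter> p t = {}) \<and>
     (\<forall>s\<in>S. spherical m' (p s)) \<and>
     (\<forall>s\<in>S. \<forall>t\<in>S. \<forall>k. s \<noteq> t \<longrightarrow> m s t = enat k \<longrightarrow>
        (\<exists>d e. Delta S' m' (p s) = Some d \<and> Delta S' m' (p t) = Some e \<and>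
           alternating_prod (artin_monoid S' m') d e k
             = alternating_prod (artin_monoid S' m') e d k \<and>
           left_lcm (artin_monoid S' m') {d, e}
             = Some (alternating_prod (artin_monoid S' m') d e k))) \<and>
     (\<forall>s\<in>S. \<forall>t\<in>S. s \<noteq> t \<longrightarrow> m s t = \<infinity> \<longrightarrow>
        (\<forall>u\<in>p s. \<not> spherical m' ({u} \<union> p t)) \<and>
        (\<forall>u\<in>p t. \<not> spherical m' ({u} \<union> p s)))"

definition lcm_homomorphism ::
  "'a set \<Rightarrow> ('a \<Rightarrow> 'a \<Rightarrow> enat) \<Rightarrow> 'b set \<Rightarrow> ('b \<Rightarrow> 'b \<Rightarrow> enat) \<Rightarrow> ('a \<Rightarrow> 'b set) \<Rightarrow>
     ('a word set \<Rightarrow> 'b word set) \<Rightarrow> bool" where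
  "lcm_homomorphism S m S' m' p \<phi> \<longleftrightarrow>
     lcm_condition S m S' m' p \<and>
     \<phi> \<in> hom (artin_group S m) (artin_group S' m') \<and>
     (\<forall>s\<in>S. Delta S' m' (p s) = Some (\<phi> (artin_gen S m s)))"

end

theory Submission
  imports Defs
begin

text \<open>
  Let \<open>\<delta> s\<close> be a positive word that represents \<open>\<Delta>\<^bsub>p(s)\<^esub>\<close>. Its image in the target Coxeter group is the
  longest element of the finite parabolic subgroup of \<open>p(s)\<close> (\<open>Delta_longest\<close>), hence an involution. The
  braid relations between the \<open>\<delta> s\<close> are part of the hypothesis, so substituting \<open>\<delta> s\<close> for \<open>s\<close>
  respects the relations of the source Coxeter group and induces a homomorphism. For injectivity one shows that the substitution preserves descents
  (\<open>no_descent_substitute\<close>): if \<open>s\<close> is not a right descent of \<open>w\<close>, then no element of \<open>p(s)\<close> is a right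
  descent of the image of \<open>w\<close>. Consequently, if \<open>s\<close> is a right descent of \<open>w\<close>, then every element of
  \<open>p(s)\<close> is a right descent of the image. Since \<open>p(s)\<close> is not empty, the image of a nontrivial \<open>w\<close>
  has a descent, so it is not trivial.

  The lemma on descents is proved by induction on the length, by splitting \<open>w\<close> along a coset of the
  dihedral subgroup of \<open>s\<close> and \<open>t\<close>, where \<open>t\<close> is a descent of \<open>w\<close>. This reduces it to alternating words in
  \<open>s\<close> and \<open>t\<close>. For an infinite bond, an undesired descent \<open>u \<in> p(s)\<close> of the image of a word that ends in
  \<open>t\<close> would be a descent together with all of \<open>p(t)\<close>; but the descents of one element generate a finite
  subgroup (\<open>all_descents_imp_longest\<close>), against the assumption that \<open>{u} \<union> p(t)\<close> is not spherical.
  For a finite bond \<open>m\<close>, the images of the alternating words of length at most \<open>m\<close> have to be reduced. They are factors of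
  the least common multiple of \<open>\<Delta>\<^bsub>p(s)\<^esub>\<close> and \<open>\<Delta>\<^bsub>p(t)\<^esub>\<close>, so it is enough that this element
  divides the lift of a longest element, which exists if \<open>p(s) \<union> p(t)\<close> is spherical
  (\<open>lcm_of_Deltas_reduced\<close>).

  That \<open>p(s) \<union> p(t)\<close> is spherical must be deduced from the existence of a common multiple
  in the positive submonoid of the Artin-Tits group. The Hecke algebra at a parameter greater
  than \<open>1\<close> does this (\<open>common_multiple_imp_longest\<close>): it is a representation of the whole group in which
  positive elements have nonnegative coefficients, and the longest elements in the support of a positive
  element have all its left divisors among the generators as left descents.

  The facts on Coxeter groups used here are the exchange condition (from the parity with which a
  word crosses a reflection), the exact order of a product of two generators (from the geometric
  representation), Matsumoto's theorem, and from these the length formula for parabolic cosets and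
  the fact that parabolic subgroups carry their own Coxeter presentation.
\<close>

section \<open>Alternating words\<close>

lemma alternating_0 [simp]: "alternating u v 0 = []"
  by (simp add: alternating_def)

lemma alternating_Suc [simp]: "alternating u v (Suc n) = u # alternating v u n"
  unfolding alternating_def
  by (subst upt_conv_Cons) (auto simp: map_Suc_upt[symmetric] simp del: upt_Suc)

lemma length_alternating [simp]: "length (alternating u v n) = n"
  by (simp add: alternating_def)

lemma map_alternating: "map f (alternating u v n) = alternating (f u) (f v) n"
  by (induction n arbitrary: u v) auto

lemma set_alternating: "set (alternating u v n) \<subseteq> {u, v}"
  by (induction n arbitrary: u v) auto

lemma alternating_snoc:
  "alternating u v (Suc n) = alternating u v n @ [if even n then u else v]"
  by (simp add: alternating_def del: alternating_Suc)

lemma rev_alternating: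
  "rev (alternating u v n) = (if even n then alternating v u n else alternating u v n)"
proof (induction n)
  case (Suc n)
  have "rev (alternating u v (Suc n)) = (if even n then u else v) # rev (alternating u v n)"
    by (simp only: alternating_snoc rev_append rev.simps append.simps)
  then show ?case using Suc by simp
qed simp

lemma alternating_add:
  "alternating u v (i + j) =
    alternating u v i @ (if even i then alternating u v j else alternating v u j)"
  by (induction i arbitrary: u v) auto

lemma alternating_double: "alternating u v (2 * n) = alternating u v n @ rev (alternating v u n)"
  unfolding mult_2 alternating_add by (simp add: rev_alternating)

section \<open>Coxeter groups as congruences on words\<close>

text \<open>The matrix is defined on the whole type, so that every word represents a group element and no
  carrier has to be tracked; a Coxeter system on a set \<open>T\<close> of letters appears as the parabolic
  subgroup of the words over \<open>T\<close>. Since the generators are involutions, words without formal inverses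
  suffice, and reversal is inversion.\<close>

locale coxeter =
  fixes m :: "'a \<Rightarrow> 'a \<Rightarrow> enat"
  assumes coxeter_matrix: "coxeter_matrix UNIV m"
begin

text \<open>Equality in the Coxeter group.\<close>

inductive eqv :: "'a list \<Rightarrow> 'a list \<Rightarrow> bool" (infix "\<approx>" 50) where
  eqv_refl [simp, intro!]: "w \<approx> w"
| eqv_sym: "u \<approx> v \<Longrightarrow> v \<approx> u"
| eqv_trans [trans]: "u \<approx> v \<Longrightarrow> v \<approx> w \<Longrightarrow> u \<approx> w"
| eqv_append: "u \<approx> v \<Longrightarrow> u' \<approx> v' \<Longrightarrow> u @ u' \<approx> v @ v'"
| eqv_square: "[s, s] \<approx> []"
| eqv_braid: "m s t = enat k \<Longrightarrow> alternating s t k \<approx> alternating t s k"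

text \<open>Equality in the monoid with the Artin presentation: unlike \<open>\<approx>\<close>, this relation does not allow the
  cancellation of squares.\<close>

inductive braid_eqv :: "'a list \<Rightarrow> 'a list \<Rightarrow> bool" (infix "\<simeq>" 50) where
  braid_refl [simp, intro!]: "w \<simeq> w"
| braid_sym: "u \<simeq> v \<Longrightarrow> v \<simeq> u"
| braid_trans [trans]: "u \<simeq> v \<Longrightarrow> v \<simeq> w \<Longrightarrow> u \<simeq> w"
| braid_append: "u \<simeq> v \<Longrightarrow> u' \<simeq> v' \<Longrightarrow> u @ u' \<simeq> v @ v'"
| braid_braid: "s \<noteq> t \<Longrightarrow> m s t = enat k \<Longrightarrow> alternating s t k \<simeq> alternating t s k"

lemma m_sym: "m s t = m t s" and m_diag [simp]: "m s s = 1" and m_nonzero [simp]: "m s t \<noteq> 0"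
  and m_eq_1: "m s t = 1 \<longleftrightarrow> s = t"
  using coxeter_matrix by (auto simp: coxeter_matrix_def)

lemma m_ge_2: "s \<noteq> t \<Longrightarrow> m s t = enat k \<Longrightarrow> 2 \<le> k"
  using m_nonzero[of s t] m_eq_1[of s t]
  by (metis One_nat_def Suc_leI enat_0 le_neq_implies_less neq0_conv numeral_2_eq_2 one_enat_def)

lemma eqv_Cons: "u \<approx> v \<Longrightarrow> s # u \<approx> s # v"
  using eqv_append[OF eqv_refl[of "[s]"]] by simp

lemma eqv_append_left: "u \<approx> v \<Longrightarrow> u @ w \<approx> v @ w"
  by (simp add: eqv_append)

lemma eqv_append_right: "u \<approx> v \<Longrightarrow> w @ u \<approx> w @ v"
  by (simp add: eqv_append)

lemma eqv_iff_left: "u \<approx> v \<Longrightarrow> u \<approx> w \<longleftrightarrow> v \<approx> w"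
  by (meson eqv_sym eqv_trans)

lemma eqv_iff_right: "u \<approx> v \<Longrightarrow> w \<approx> u \<longleftrightarrow> w \<approx> v"
  by (meson eqv_sym eqv_trans)

lemma eqv_cancel_letter: "u @ s # s # v \<approx> u @ v"
  using eqv_append[OF eqv_refl eqv_append[OF eqv_square eqv_refl], of u s v] by simp

lemma eqv_rev_left: "rev w @ w \<approx> []"
proof (induction w)
  case (Cons s w)
  then show ?case using eqv_cancel_letter[of "rev w" s w] by (auto intro: eqv_trans)
qed simp

lemma eqv_rev_right: "w @ rev w \<approx> []"
  using eqv_rev_left[of "rev w"] by simp

lemma eqv_cancel_left: "u @ v \<approx> u @ w \<longleftrightarrow> v \<approx> w"
proof
  assume "u @ v \<approx> u @ w"
  from eqv_append_right[OF this, of "rev u"] 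
  have "(rev u @ u) @ v \<approx> (rev u @ u) @ w" by simp
  then show "v \<approx> w"
    using eqv_append_left[OF eqv_rev_left[of u]] by (metis append_Nil eqv_sym eqv_trans)
qed (rule eqv_append_right)

lemma eqv_cancel_right: "v @ u \<approx> w @ u \<longleftrightarrow> v \<approx> w"
proof
  assume "v @ u \<approx> w @ u"
  from eqv_append_left[OF this, of "rev u"] 
  have "v @ (u @ rev u) \<approx> w @ (u @ rev u)" by simp
  then show "v \<approx> w"
    using eqv_append_right[OF eqv_rev_right[of u]] by (metis append_Nil2 eqv_sym eqv_trans)
qed (rule eqv_append_left)

lemma eqv_Cons_cancel [simp]: "s # v \<approx> s # w \<longleftrightarrow> v \<approx> w"
  using eqv_cancel_left[of "[s]"] by simp

lemma eqv_move_left: "u @ v \<approx> w \<longleftrightarrow> v \<approx> rev u @ w"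
proof -
  have "u @ v \<approx> w \<longleftrightarrow> u @ v \<approx> u @ rev u @ w"
    using eqv_append_left[OF eqv_rev_right, of u w] by (metis append_Nil append_assoc eqv_iff_right)
  then show ?thesis by (simp only: eqv_cancel_left)
qed

lemma eqv_move_right: "v @ u \<approx> w \<longleftrightarrow> v \<approx> w @ rev u"
proof -
  have "v @ u \<approx> w \<longleftrightarrow> v @ u \<approx> (w @ rev u) @ u"
    using eqv_append_right[OF eqv_rev_left, of w u] by (metis append_Nil2 append_assoc eqv_iff_right)
  then show ?thesis by (simp only: eqv_cancel_right)
qed

lemma eqv_move_letter: "s # v \<approx> w \<longleftrightarrow> v \<approx> s # w"
  using eqv_move_left[of "[s]"] by simp

lemma eqv_rev:
  assumes "u \<approx> v"
  shows "rev u \<approx> rev v"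
proof -
  have "u @ rev v \<approx> []" using eqv_trans[OF eqv_append_left[OF assms] eqv_rev_right] .
  then show ?thesis using eqv_move_left[of u "rev v" "[]"] by (simp add: eqv_sym)
qed

lemma eqv_parity: "u \<approx> v \<Longrightarrow> even (length u) = even (length v)"
  by (induction rule: eqv.induct) auto

lemma braid_set: "u \<simeq> v \<Longrightarrow> set u = set v"
proof (induction rule: braid_eqv.induct)
  case (braid_braid s t k)
  then obtain j where "k = Suc (Suc j)"
    by (metis m_ge_2 add_2_eq_Suc le_Suc_ex)
  then show ?case using set_alternating[of s t j] set_alternating[of t s j] by auto
qed auto

definition len :: "'a list \<Rightarrow> nat" where
  "len w = (LEAST n. \<exists>v. v \<approx> w \<and> length v = n)"

definition reduced :: "'a list \<Rightarrow> bool" where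
  "reduced w \<longleftrightarrow> len w = length w"

lemma len_le_eqv: "v \<approx> w \<Longrightarrow> len w \<le> length v"
  unfolding len_def by (rule Least_le) auto

lemma len_le_length: "len w \<le> length w"
  by (rule len_le_eqv) simp

lemma len_cong: "u \<approx> v \<Longrightarrow> len u = len v"
  unfolding len_def using eqv_iff_right[of u v] by simp

lemma exists_reduced:
  obtains v where "v \<approx> w" "reduced v" "length v = len w"
proof -
  have "\<exists>v. v \<approx> w \<and> length v = len w"
    unfolding len_def by (rule LeastI[of _ "length w"]) auto
  then show ?thesis using that len_cong unfolding reduced_def by metis
qed

lemma len_Nil [simp]: "len [] = 0"
  using len_le_length[of "[]"] by simp

lemma len_eq_0: "len w = 0 \<longleftrightarrow> w \<approx> []"
  by (metis exists_reduced eqv_sym len_Nil len_cong length_0_conv)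

lemma len_parity: "even (len w) = even (length w)"
  by (metis exists_reduced eqv_parity)

lemma len_append: "len (u @ v) \<le> len u + len v"
proof -
  obtain u' v' where "u' \<approx> u" "length u' = len u" "v' \<approx> v" "length v' = len v"
    by (metis exists_reduced)
  then show ?thesis using len_le_eqv[OF eqv_append, of u' u v' v] by simp
qed

lemma len_rev [simp]: "len (rev w) = len w"
proof -
  have "len (rev w) \<le> len w" for w
    by (metis exists_reduced eqv_rev len_le_eqv length_rev)
  from this[of w] this[of "rev w"] show ?thesis by simp
qed

lemma len_singleton [simp]: "len [s] = 1"
  using len_le_length[of "[s]"] len_parity[of "[s]"] by (cases "len [s]") auto

lemma len_Cons_le: "len (s # w) \<le> Suc (len w)"
  using len_append[of "[s]" w] by simp

lemma len_Cons_cases: "len (s # w) = Suc (len w) \<or> Suc (len (s # w)) = len w"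
proof -
  have "len w = len (s # s # w)"
    using eqv_cancel_letter[of "[]" s w] by (metis append_Nil len_cong)
  then have "len w \<le> Suc (len (s # w))" by (metis len_Cons_le)
  moreover have "even (len (s # w)) \<noteq> even (len w)" by (simp add: len_parity)
  then have "len (s # w) \<noteq> len w" by metis
  ultimately show ?thesis using len_Cons_le[of s w] by linarith
qed

lemma len_snoc_rev: "len (w @ [s]) = len (s # rev w)"
  by (metis len_rev rev.simps(2) rev_rev_ident)

lemma len_snoc_cases: "len (w @ [s]) = Suc (len w) \<or> Suc (len (w @ [s])) = len w"
  using len_Cons_cases[of s "rev w"] by (simp add: len_snoc_rev)

lemma reduced_append:
  assumes "reduced (u @ v)"
  shows "reduced u" "reduced v"
  using assms len_append[of u v] len_le_length[of u] len_le_length[of v]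
  unfolding reduced_def by auto

lemma reduced_rev: "reduced (rev w) \<longleftrightarrow> reduced w"
  by (simp add: reduced_def)

lemma reduced_eqv_length: "reduced u \<Longrightarrow> reduced v \<Longrightarrow> u \<approx> v \<Longrightarrow> length u = length v"
  by (metis len_cong reduced_def)

lemma reduced_no_square: "\<not> reduced (u @ s # s # v)"
  using len_le_eqv[OF eqv_sym[OF eqv_cancel_letter[of u s v]]] unfolding reduced_def by simp

section \<open>The exchange condition\<close>

text \<open>A word \<open>s\<^sub>1 \<dots> s\<^sub>n\<close> crosses the reflections \<open>s\<^sub>1 \<dots> s\<^sub>i \<dots> s\<^sub>1\<close>. The predicate records whether the
  reflection \<open>r\<close> is crossed an odd number of times. This parity depends only on the group element, and
  it detects the descents; that is the whole reason for the exchange condition.\<close>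

primrec inversion :: "'a list \<Rightarrow> 'a list \<Rightarrow> bool" where
  "inversion [] r = False"
| "inversion (s # w) r = ((r \<approx> [s]) \<noteq> inversion w (s # r @ [s]))"

lemma inversion_append: "inversion (u @ v) r = (inversion u r \<noteq> inversion v (rev u @ r @ u))"
  by (induction u arbitrary: r) auto

lemma inversion_cong_right: "r \<approx> r' \<Longrightarrow> inversion w r = inversion w r'"
proof (induction w arbitrary: r r')
  case (Cons s w)
  have "s # r @ [s] \<approx> s # r' @ [s]"
    using Cons.prems by (simp add: eqv_append_left)
  then have "inversion w (s # r @ [s]) = inversion w (s # r' @ [s])"
    by (rule Cons.IH)
  then show ?case using Cons.prems using eqv_iff_left[of r r' "[s]"] by simp
qed simp

lemma inversion_alternating:
  "inversion (alternating s t n) r = odd (card {i. i < n \<and> r \<approx> alternating s t (2 * i + 1)})"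
proof (induction n arbitrary: s t r)
  case (Suc n)
  have "s # r @ [s] \<approx> alternating t s (2 * i + 1) \<longleftrightarrow> r \<approx> alternating s t (2 * Suc i + 1)" for i
  proof -
    have "s # r @ [s] \<approx> alternating t s (2 * i + 1) \<longleftrightarrow> r \<approx> s # alternating t s (2 * i + 1) @ [s]"
      using eqv_move_left[of "[s]" "r @ [s]"] eqv_move_right[of r "[s]"] by simp
    also have "s # alternating t s (2 * i + 1) @ [s] = alternating s t (Suc (2 * i + 1)) @ [s]"
      by simp
    also have "\<dots> = alternating s t (Suc (Suc (2 * i + 1)))"
      using alternating_snoc[of s t "Suc (2 * i + 1)"] by simp
    finally show ?thesis by simp
  qed
  then have *: "inversion (alternating t s n) (s # r @ [s])
      = odd (card {i. i < n \<and> r \<approx> alternating s t (2 * Suc i + 1)})"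
    unfolding Suc by simp
  have "{i. i < Suc n \<and> r \<approx> alternating s t (2 * i + 1)}
      = (if r \<approx> [s] then {0} else {}) \<union> Suc ` {i. i < n \<and> r \<approx> alternating s t (2 * Suc i + 1)}"
    (is "?A = ?B \<union> Suc ` ?C")
    by (auto simp: less_Suc_eq_0_disj image_iff)
  moreover have "card (?B \<union> Suc ` ?C) = card ?B + card ?C"
    by (subst card_Un_disjoint) (auto simp: card_image)
  ultimately show ?case using * by simp
qed simp

text \<open>The two sides of a braid relation cross the same reflections, in opposite orders.\<close>

lemma inversion_braid:
  assumes "alternating s t k \<approx> alternating t s k"
  shows "inversion (alternating s t k) r = inversion (alternating t s k) r"
proof -
  \<comment> \<open>The relation says that the product of the \<open>2 * k\<close> letters is trivial, so complementary pieces are inverse.\<close>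
  have rot: "alternating t s (2 * (k - 1 - i) + 1) \<approx> alternating s t (2 * i + 1)" if "i < k" for i
  proof -
    have "alternating s t (2 * k) \<approx> []"
      unfolding alternating_double by (rule eqv_trans[OF eqv_append_left[OF assms] eqv_rev_right])
    moreover have "2 * k = (2 * i + 1) + (2 * (k - 1 - i) + 1)" using that by simp
    then have "alternating s t (2 * k)
        = alternating s t (2 * i + 1) @ alternating t s (2 * (k - 1 - i) + 1)"
      by (simp only: alternating_add) simp
    ultimately have "alternating t s (2 * (k - 1 - i) + 1) \<approx> rev (alternating s t (2 * i + 1))"
      using eqv_move_left[of "alternating s t (2 * i + 1)" _ "[]"] by (simp del: alternating_Suc)
    then show ?thesis by (simp add: rev_alternating del: alternating_Suc)
  qed
  have "bij_betw (\<lambda>i. k - 1 - i) {i. i < k \<and> r \<approx> alternating s t (2 * i + 1)}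
     {i. i < k \<and> r \<approx> alternating t s (2 * i + 1)}"
  proof (rule bij_betwI[where g = "\<lambda>i. k - 1 - i"])
    show "(\<lambda>i. k - 1 - i) \<in> {i. i < k \<and> r \<approx> alternating s t (2 * i + 1)}
        \<rightarrow> {i. i < k \<and> r \<approx> alternating t s (2 * i + 1)}"
    proof (intro funcsetI CollectI conjI; elim CollectE conjE)
      fix i assume "i < k" "r \<approx> alternating s t (2 * i + 1)"
      then show "r \<approx> alternating t s (2 * (k - 1 - i) + 1)"
        using eqv_iff_right[OF rot[of i], of r] by blast
    qed simp
    show "(\<lambda>i. k - 1 - i) \<in> {i. i < k \<and> r \<approx> alternating t s (2 * i + 1)}
        \<rightarrow> {i. i < k \<and> r \<approx> alternating s t (2 * i + 1)}"
    proof (intro funcsetI CollectI conjI; elim CollectE conjE)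
      fix i assume "i < k" "r \<approx> alternating t s (2 * i + 1)"
      moreover from this have "k - 1 - (k - 1 - i) = i" "k - 1 - i < k" by simp_all
      ultimately show "r \<approx> alternating s t (2 * (k - 1 - i) + 1)"
        using eqv_iff_right[OF rot[of "k - 1 - i"], of r] by metis
    qed simp
  qed auto
  then show ?thesis by (simp only: inversion_alternating bij_betw_same_card)
qed

lemma inversion_cong: "u \<approx> v \<Longrightarrow> inversion u r = inversion v r"
proof (induction arbitrary: r rule: eqv.induct)
  case (eqv_append u v u' v')
  have "rev u @ r @ u \<approx> rev v @ r @ v"
    by (intro eqv.eqv_append eqv_rev eqv_append.hyps eqv_refl)
  then show ?case
    using inversion_cong_right[of "rev u @ r @ u" "rev v @ r @ v"]
    by (simp only: inversion_append eqv_append.IH)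
next
  case (eqv_square s)
  have "s # r @ [s] \<approx> [s] \<longleftrightarrow> r \<approx> [s]"
    using eqv_move_left[of "[s]" "r @ [s]" "[s]"] eqv_move_right[of r "[s]" "[s,s]"]
      eqv_cancel_letter[of "[]" s "[s]"] by (metis append_Cons append_Nil eqv_iff_right rev.simps)
  then show ?case by simp
next
  case (eqv_braid s t k)
  then show ?case by (intro inversion_braid eqv.eqv_braid)
qed simp_all

lemma inversion_imp_letter:
  "inversion w r \<Longrightarrow> \<exists>a c b. w = a @ c # b \<and> r \<approx> a @ c # rev a"
proof (induction w arbitrary: r)
  case (Cons s w)
  show ?case
  proof (cases "r \<approx> [s]")
    case True
    then show ?thesis by (intro exI[of _ "[]"]) auto
  next
    case False
    with Cons.prems have "inversion w (s # r @ [s])" by simp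
    from Cons.IH[OF this] obtain a c b where "w = a @ c # b" "s # r @ [s] \<approx> a @ c # rev a"
      by blast
    moreover from this have "r \<approx> (s # a) @ c # rev (s # a)"
      using eqv_move_left[of "[s]" "r @ [s]"] eqv_move_right[of r "[s]"] by simp
    ultimately show ?thesis by (metis append_Cons)
  qed
qed simp

lemma inversion_imp_delete:
  assumes "inversion w [s]"
  obtains a c b where "w = a @ c # b" "s # w \<approx> a @ b"
proof -
  obtain a c b where w: "w = a @ c # b" and "[s] \<approx> a @ c # rev a"
    using inversion_imp_letter[OF assms] by blast
  from eqv_append_left[OF this(2), of w] have "s # w \<approx> (a @ [c]) @ (rev a @ a) @ c # b" by (simp add: w)
  also have "(a @ [c]) @ (rev a @ a) @ c # b \<approx> (a @ [c]) @ [] @ c # b"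
    by (intro eqv_append eqv_rev_left eqv_refl)
  also have "(a @ [c]) @ [] @ c # b \<approx> a @ b" using eqv_cancel_letter[of a c b] by simp
  finally show thesis using that w by blast
qed

text \<open>If \<open>s\<close> is crossed by \<open>w\<close>, then deleting the letter at which this happens gives a word for
  \<open>s # w\<close>. If not, then \<open>s\<close> is crossed by \<open>s # w\<close>, and the same argument applies to that word.\<close>

lemma inversion_iff_descent: "inversion w [s] \<longleftrightarrow> len (s # w) < len w"
proof -
  have *: "len (s # w) < len w" if "inversion w [s]" for w
  proof -
    obtain v where v: "v \<approx> w" "length v = len w" by (metis exists_reduced)
    then have "inversion v [s]" using that inversion_cong by blast
    then obtain a c b where "v = a @ c # b" "s # v \<approx> a @ b" by (rule inversion_imp_delete)
    then have "len (s # v) < length v"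
      using len_le_eqv[OF eqv_sym[of "s # v" "a @ b"]] by simp
    then show ?thesis using v len_cong[of "s # v" "s # w"] by simp
  qed
  moreover have "inversion w [s]" if "len (s # w) < len w"
  proof (rule ccontr)
    assume "\<not> inversion w [s]"
    then have "inversion (s # w) [s]"
      using inversion_cong_right[of "[s, s, s]" "[s]"] eqv_cancel_letter[of "[]" s "[s]"] by simp
    from *[OF this] show False
      using that len_cong[of "s # s # w" w] eqv_cancel_letter[of "[]" s w] by simp
  qed
  ultimately show ?thesis by blast
qed

theorem exchange:
  assumes "len (s # w) < len w"
  obtains a c b where "w = a @ c # b" "s # w \<approx> a @ b"
  using assms inversion_imp_delete unfolding inversion_iff_descent[symmetric] by blast

corollary exchange_right:
  assumes "len (w @ [s]) < len w"
  obtains a c b where "w = a @ c # b" "w @ [s] \<approx> a @ b"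
proof -
  have "len (s # rev w) < len (rev w)" using assms by (simp add: len_snoc_rev)
  then obtain a c b where 1: "rev w = a @ c # b" and 2: "s # rev w \<approx> a @ b" by (rule exchange)
  have "w = rev b @ c # rev a" using arg_cong[OF 1, of rev] by simp
  moreover have "w @ [s] \<approx> rev b @ rev a" using eqv_rev[OF 2] by simp
  ultimately show thesis using that by blast
qed

end

section \<open>The order of a product of two generators\<close>

lemma sin_pi_over_pos:
  assumes "2 \<le> (k::nat)"
  shows "sin (pi / k) > 0"
  using assms by (intro sin_gt_zero) (auto simp: field_simps)

context coxeter
begin

definition cosine :: "'a \<Rightarrow> 'a \<Rightarrow> real" where
  "cosine s t = (case m s t of enat k \<Rightarrow> cos (pi / k) | \<infinity> \<Rightarrow> 1)"

lemma cosine_sym: "cosine s t = cosine t s"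
  by (simp add: cosine_def m_sym)

lemma cosine_diag [simp]: "cosine s s = -1"
  by (simp add: cosine_def one_enat_def)

text \<open>The dual of the geometric representation: the function \<open>f\<close> is a linear form, given by its values
  on the simple roots. In this form the action involves no sum over the generators, so it makes sense
  for any set of them.\<close>

definition reflect :: "'a \<Rightarrow> ('a \<Rightarrow> real) \<Rightarrow> 'a \<Rightarrow> real" where
  "reflect s f = (\<lambda>u. f u + 2 * cosine s u * f s)"

definition reflects :: "'a list \<Rightarrow> ('a \<Rightarrow> real) \<Rightarrow> 'a \<Rightarrow> real" where
  "reflects w f = foldr reflect w f"

lemma reflects_simps [simp]: "reflects [] f = f" "reflects (s # w) f = reflect s (reflects w f)"
  "reflects (u @ v) f = reflects u (reflects v f)"
  by (simp_all add: reflects_def)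

lemma reflect_involution [simp]: "reflect s (reflect s f) = f"
  by (auto simp: reflect_def algebra_simps)

text \<open>On the values at \<open>s\<close> and \<open>t\<close>, written as \<open>g \<theta>\<close> and \<open>g (\<alpha> - \<theta>)\<close>, the two reflections act by
  \<open>\<theta> \<mapsto> - \<theta>\<close> and \<open>\<theta> \<mapsto> 2 * \<alpha> - \<theta>\<close>, so their product is a rotation. The function \<open>g\<close> is a multiple of the
  sine for a finite bond and the identity for an infinite one.\<close>

lemma reflects_rotation:
  assumes g: "\<And>x. g (- x) = - g (x::real)"
    and g2: "\<And>x. g (\<alpha> - x) + 2 * cosine s t * g x = g (\<alpha> + x)"
    and f: "f s = g \<theta>" "f t = g (\<alpha> - \<theta>)"
  shows "reflects (alternating s t (2 * n)) f s = g (\<theta> - 2 * n * \<alpha>) \<and>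
         reflects (alternating s t (2 * n)) f t = g (\<alpha> - (\<theta> - 2 * n * \<alpha>))"
proof (induction n)
  case (Suc n)
  let ?x = "\<theta> - 2 * n * \<alpha>"
  let ?h = "reflects (alternating s t (2 * n)) f"
  have t: "reflect t ?h t = g (?x - \<alpha>)" "reflect t ?h s = g (\<alpha> - (?x - \<alpha>))"
    using Suc g[of "\<alpha> - ?x"] g2[of "\<alpha> - ?x"] by (simp_all add: reflect_def cosine_sym algebra_simps)
  have st: "reflect s (reflect t ?h) s = g (?x - \<alpha> - \<alpha>)"
       "reflect s (reflect t ?h) t = g (\<alpha> - (?x - \<alpha> - \<alpha>))"
    using t g[of "\<alpha> - (?x - \<alpha>)"] g2[of "\<alpha> - (?x - \<alpha>)"] by (simp_all add: reflect_def[of s] algebra_simps)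
  have "alternating s t (2 * Suc n) = s # t # alternating s t (2 * n)" by simp
  then have "reflects (alternating s t (2 * Suc n)) f = reflect s (reflect t ?h)"
    by (simp only: reflects_simps)
  moreover have "?x - \<alpha> - \<alpha> = \<theta> - 2 * Suc n * \<alpha>" by (simp add: algebra_simps)
  ultimately show ?case using st by (simp only: of_nat_mult of_nat_numeral)
qed (use f in simp)

lemma reflects_invariant:
  assumes "\<And>f. h (reflect s f) = h f" "\<And>f. h (reflect t f) = (h f::real)" "set w \<subseteq> {s, t}"
  shows "h (reflects w f) = h f"
  using assms(3) by (induction w) (auto simp: assms(1,2))

text \<open>The rotation has angle \<open>2 * pi / k\<close>, so its \<open>k\<close>-th power fixes the values at \<open>s\<close> and \<open>t\<close>. For any other
  \<open>u\<close>, some linear combination of the values at \<open>u\<close>, \<open>s\<close> and \<open>t\<close> is invariant under both reflections,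
  because the Gram determinant \<open>1 - (cos (pi / k))\<^sup>2\<close> of the plane is not zero.\<close>

lemma reflects_braid:
  assumes st: "s \<noteq> t" and k: "m s t = enat k"
  shows "reflects (alternating s t (2 * k)) f = f"
proof
  fix u
  let ?c = "cos (pi / k)"
  let ?w = "alternating s t (2 * k)"
  have c: "cosine s t = ?c" "cosine t s = ?c" using k by (simp_all add: cosine_def m_sym)
  have k2: "k \<ge> 2" using m_ge_2[OF st k] .
  have sin: "sin (pi / k) > 0" using sin_pi_over_pos[OF k2] .
  have plane: "reflects ?w f s = f s \<and> reflects ?w f t = f t"
  proof -
    obtain R \<theta> where R: "f s = R * sin \<theta>" "(f t + ?c * f s) / sin (pi / k) = R * cos \<theta>"
      using polar_Ex by metis
    then have "f t = R * sin (pi / k - \<theta>)"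
      using sin by (simp add: sin_diff field_simps)
    moreover have "R * sin (pi / k - x) + 2 * cosine s t * (R * sin x) = R * sin (pi / k + x)" for x
      by (simp add: c sin_diff sin_add algebra_simps)
    moreover have "R * sin (\<theta> - 2 * k * (pi / k)) = R * sin \<theta>"
       "R * sin (pi / k - (\<theta> - 2 * k * (pi / k))) = R * sin (pi / k - \<theta>)"
      using k2 by (simp_all add: sin_diff cos_diff)
    ultimately show ?thesis
      using reflects_rotation[of "\<lambda>x. R * sin x" "pi / k" s t f \<theta> k] R(1) by simp
  qed
  \<comment> \<open>The solution of the linear system that expresses invariance of the form below.\<close>
  define a b where "a = (?c * cosine t u + cosine s u) / (1 - ?c\<^sup>2)"
    and "b = (?c * cosine s u + cosine t u) / (1 - ?c\<^sup>2)"
  have nz: "1 - ?c\<^sup>2 \<noteq> 0" using sin by (simp add: cos_squared_eq)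
  have ab: "cosine s u - a + ?c * b = 0" "cosine t u + ?c * a - b = 0"
    using nz unfolding a_def b_def by (simp_all add: field_simps power2_eq_square)
  let ?h = "\<lambda>f. f u + a * f s + b * f t"
  have "?h (reflects ?w f) = ?h f"
  proof (rule reflects_invariant[of ?h s t])
    fix f
    have "?h (reflect s f) - ?h f = 2 * f s * (cosine s u - a + ?c * b)"
      by (simp add: reflect_def c algebra_simps)
    then show "?h (reflect s f) = ?h f" using ab by simp
    have "?h (reflect t f) - ?h f = 2 * f t * (cosine t u + ?c * a - b)"
      by (simp add: reflect_def c algebra_simps)
    then show "?h (reflect t f) = ?h f" using ab by simp
  qed (rule set_alternating)
  then show "reflects ?w f u = f u" using plane by simp
qed

lemma reflects_rev: "reflects (rev w) (reflects w f) = f"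
  by (induction w arbitrary: f) auto

lemma reflects_cong: "u \<approx> v \<Longrightarrow> reflects u f = reflects v f"
proof (induction arbitrary: f rule: eqv.induct)
  case (eqv_braid s t k)
  show ?case
  proof (cases "s = t")
    case False
    have "reflects (alternating s t k) f
        = reflects (alternating s t (2 * k)) (reflects (alternating t s k) f)"
      by (simp add: alternating_double reflects_rev del: alternating_Suc)
    then show ?thesis using reflects_braid[OF False eqv_braid] by simp
  qed simp
qed simp_all

text \<open>The presentation only bounds the order of \<open>s * t\<close> from above; the rotation shows that the order is
  not smaller. Without this, braid relations derived in the group could fail to be relations of the
  Artin presentation.\<close>

theorem dihedral_order:
  assumes st: "s \<noteq> t" and eq: "alternating s t j \<approx> alternating t s j" and j: "j > 0"
  obtains k where "m s t = enat k" "k \<le> j"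
proof -
  have "alternating s t (2 * j) \<approx> []"
    unfolding alternating_double by (rule eqv_trans[OF eqv_append_left[OF eq] eqv_rev_right])
  from reflects_cong[OF this] have id: "reflects (alternating s t (2 * j)) f = f" for f by simp
  show thesis
  proof (cases "m s t")
    case (enat k)
    have k2: "k \<ge> 2" using m_ge_2[OF st enat] .
    let ?\<alpha> = "pi / k"
    let ?f = "\<lambda>u. if u = s then 0 else sin ?\<alpha>"
    have c: "cosine s t = cos ?\<alpha>" using enat by (simp add: cosine_def)
    have sin: "sin ?\<alpha> > 0" using sin_pi_over_pos[OF k2] .
    have "sin (?\<alpha> - x) + 2 * cosine s t * sin x = sin (?\<alpha> + x)" for x
      by (simp add: c sin_diff sin_add)
    from reflects_rotation[of sin ?\<alpha> s t ?f 0 j, OF _ this]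
    have "0 = sin (- (2 * j * ?\<alpha>))" "sin ?\<alpha> = sin (?\<alpha> + 2 * j * ?\<alpha>)"
      using st unfolding id by simp_all
    then have "sin (2 * j * ?\<alpha>) = 0" "sin ?\<alpha> = sin ?\<alpha> * cos (2 * j * ?\<alpha>)"
      by (simp_all add: sin_add)
    with sin have "cos (2 * j * ?\<alpha>) = 1" by simp
    then obtain n :: int where "real (2 * j) * ?\<alpha> = real_of_int n * 2 * pi"
      using cos_one_2pi_int by auto
    then have "real j = n * real k" using k2 by (simp add: field_simps)
    then have "int j = n * int k" by (metis of_int_eq_iff of_int_mult of_int_of_nat_eq)
    then have "k \<le> j" using j by (metis dvd_triv_right int_dvd_int_iff nat_dvd_not_less not_le)
    then show thesis using that enat by blast
  next
    case infinity
    let ?f = "\<lambda>u. if u = s then 0 else 1"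
    have "cosine s t = 1" using infinity by (simp add: cosine_def)
    then have "0 = 0 - 2 * j * (1::real)"
      using reflects_rotation[of "\<lambda>x. x" 1 s t ?f 0 j] st unfolding id by simp
    then show thesis using j by simp
  qed
qed

section \<open>Braid equivalence of reduced words\<close>

lemma reduced_alternating:
  "reduced w \<Longrightarrow> set w \<subseteq> {s, t} \<Longrightarrow> w \<noteq> [] \<Longrightarrow> hd w = s \<Longrightarrow> w = alternating s t (length w)"
proof (induction w arbitrary: s t)
  case (Cons x w)
  show ?case
  proof (cases w)
    case (Cons y w')
    have "y \<noteq> x" using Cons.prems(1) reduced_no_square[of "[]" x w'] Cons by auto
    then have "hd w = t" using Cons.prems Cons by auto
    then have "w = alternating t s (length w)"
      using Cons.prems Cons reduced_append(2)[of "[x]" w] by (intro Cons.IH) auto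
    then show ?thesis using Cons.prems by simp
  qed (use Cons.prems in simp)
qed simp

lemma alternating_not_reduced:
  assumes "m s t = enat k" "k < n"
  shows "\<not> reduced (alternating s t n @ w)"
proof
  assume *: "reduced (alternating s t n @ w)"
  obtain j where j: "n = Suc k + j" using assms(2) by (metis Suc_leI le_Suc_ex)
  have k0: "k \<noteq> 0" using assms(1) m_nonzero[of s t] by (auto simp: zero_enat_def)
  have "alternating s t n @ w
      = alternating s t (Suc k) @ (if even (Suc k) then alternating s t j else alternating t s j) @ w"
    unfolding j alternating_add by simp
  with * have "reduced (alternating s t (Suc k))" using reduced_append(1) by metis
  moreover have "alternating s t (Suc k) \<approx> s # alternating s t k"
    using eqv_braid assms(1) by (simp add: eqv_sym)
  moreover obtain i where "k = Suc i" using k0 by (cases k) auto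
  then have "s # alternating s t k \<approx> alternating t s i"
    using eqv_cancel_letter[of "[]"] by simp
  ultimately have "alternating t s i \<approx> alternating s t (Suc k)"
    by (meson eqv_sym eqv_trans)
  then have "len (alternating s t (Suc k)) \<le> i"
    using len_le_eqv by fastforce
  then show False using \<open>reduced (alternating s t (Suc k))\<close> \<open>k = Suc i\<close>
    by (simp add: reduced_def del: alternating_Suc)
qed

text \<open>The exchange condition deletes one letter. In the tail, this lengthens the alternating prefix. At
  the end of the prefix, it gives a dihedral relation. Elsewhere in the prefix it is impossible,
  because the prefix would contain a square.\<close>

lemma alternating_prefix_extend:
  assumes red: "reduced (alternating a b j @ x)" and j: "j > 0"
    and desc: "len (b # alternating a b j @ x) < len (alternating a b j @ x)"
  shows "alternating a b j \<approx> alternating b a j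
     \<or> (\<exists>x'. reduced (alternating b a (Suc j) @ x') \<and> alternating b a (Suc j) @ x' \<approx> alternating a b j @ x)"
proof -
  let ?w = "alternating a b j @ x"
  obtain p c q where pq: "?w = p @ c # q" "b # ?w \<approx> p @ q" using exchange[OF desc] by blast
  from pq(2) have w: "?w \<approx> b # p @ q" using eqv_move_letter by blast
  have "length (b # p @ q) = length ?w" using pq(1) by simp
  then have red': "reduced (b # p @ q)"
    using red len_cong[OF w] unfolding reduced_def by metis
  show ?thesis
  proof (cases "length p < j")
    case False
    then have "p = alternating a b j @ drop j p"
      using pq(1) by (metis append_eq_append_conv_if length_alternating not_less append_take_drop_id)
    then obtain x' where "p = alternating a b j @ x'" by blast
    then have "b # p @ q = alternating b a (Suc j) @ x' @ q" by simp
    then show ?thesis using red' w eqv_sym by metis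
  next
    case True
    then obtain i where i: "j = Suc (length p + i)" by (metis less_imp_Suc_add)
    have p: "p = alternating a b (length p)"
    proof -
      have "p = take (length p) ?w" using pq(1) by simp
      also have "\<dots> = take (length p) (alternating a b j)" using True by simp
      also have "\<dots> = alternating a b (length p)"
        unfolding i add_Suc_right[symmetric] alternating_add by simp
      finally show ?thesis .
    qed
    have q: "q = (if even (length p) then alternating b a i else alternating a b i) @ x"
    proof -
      have "p @ c # q = alternating a b (length p + Suc i) @ x" using pq(1) i by simp
      also have "\<dots> = alternating a b (length p)
          @ (if even (length p) then alternating a b (Suc i) else alternating b a (Suc i)) @ x"
        unfolding alternating_add by simp
      finally have "c # q = (if even (length p) then alternating a b (Suc i) else alternating b a (Suc i)) @ x"
        using p by (metis same_append_eq)
      then show ?thesis by (auto split: if_splits)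
    qed
    have "i = 0"
    proof (rule ccontr)
      assume "i \<noteq> 0"
      then obtain i' where i': "i = Suc i'" by (cases i) auto
      have bp: "b # p = alternating b a (length p) @ [if even (length p) then b else a]"
        using alternating_snoc[of b a "length p"] p by simp
      have "b # p @ q = alternating b a (length p) @ (if even (length p) then b else a)
          # (if even (length p) then b else a) # tl q"
        using bp q i' by (cases "even (length p)") auto
      then show False using red' reduced_no_square by metis
    qed
    with q have "q = x" by simp
    moreover have "b # p = alternating b a j" using p i \<open>i = 0\<close> by simp
    ultimately have "?w \<approx> alternating b a j @ x" using w by (metis append_Cons)
    then show ?thesis using eqv_cancel_right by blast
  qed
qed

text \<open>Among the reduced words with an alternating prefix in \<open>s\<close> and \<open>t\<close>, one with the longest prefix
  cannot be extended any further, so its prefix satisfies a dihedral relation; hence \<open>s\<close> and \<open>t\<close>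
  have a finite bond, which is not longer than the prefix.\<close>

lemma two_descents:
  assumes red: "reduced w" and st: "s \<noteq> t"
    and s: "len (s # w) < len w" and t: "len (t # w) < len w"
  obtains k x where "m s t = enat k" "w \<approx> alternating s t k @ x" "w \<approx> alternating t s k @ x"
    "reduced (alternating s t k @ x)" "reduced (alternating t s k @ x)"
proof -
  \<comment> \<open>There is such a word with \<open>j = 0\<close>, and \<open>j\<close> is bounded by the length, so a maximal \<open>j\<close> exists.\<close>
  define P where "P j \<longleftrightarrow> (\<exists>a b x. {a, b} = {s, t} \<and> reduced (alternating a b j @ x)
     \<and> alternating a b j @ x \<approx> w)" for j
  have P0: "P 0" unfolding P_def using red by auto
  have le: "j \<le> length w" if Pj: "P j" for j
  proof -
    obtain a b x where "reduced (alternating a b j @ x)" "alternating a b j @ x \<approx> w"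
      using Pj unfolding P_def by blast
    then have "length (alternating a b j @ x) = length w" using red reduced_eqv_length by blast
    then show ?thesis by simp
  qed
  obtain j where Pj: "P j" and max: "\<And>j'. P j' \<Longrightarrow> j' \<le> j"
    using ex_has_greatest_nat[of P 0 id "Suc (length w)"] P0 le by (auto simp: less_Suc_eq_le)
  have "P 1"
  proof -
    obtain p c q where pq: "w = p @ c # q" "s # w \<approx> p @ q" using exchange[OF s] by blast
    have "s # p @ q \<approx> w" using pq(2) eqv_move_letter eqv_sym by blast
    moreover have "reduced (s # p @ q)"
      using red len_cong[OF calculation] pq(1) unfolding reduced_def by simp
    ultimately show ?thesis unfolding P_def by (intro exI[of _ s] exI[of _ t] exI[of _ "p @ q"]) auto
  qed
  then have j0: "j > 0" using max by fastforce
  obtain a b x where ab: "{a, b} = {s, t}" and rx: "reduced (alternating a b j @ x)"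
    and wx: "alternating a b j @ x \<approx> w"
    using Pj unfolding P_def by blast
  have "a \<noteq> b" using ab st by auto
  have "b = s \<or> b = t" using ab by auto
  then have "len (b # w) < len w" using s t by auto
  then have "len (b # alternating a b j @ x) < len (alternating a b j @ x)"
    using len_cong[OF wx] len_cong[OF eqv_Cons[OF wx]] by metis
  then consider "alternating a b j \<approx> alternating b a j"
    | x' where "reduced (alternating b a (Suc j) @ x')"
       "alternating b a (Suc j) @ x' \<approx> alternating a b j @ x"
    using alternating_prefix_extend[OF rx j0] by blast
  then show thesis
  proof cases
    case 1
    then obtain k where k: "m a b = enat k" "k \<le> j" using dihedral_order \<open>a \<noteq> b\<close> j0 by blast
    define y where "y = (if even k then alternating a b (j - k) else alternating b a (j - k)) @ x"
    have eq: "alternating a b j @ x = alternating a b k @ y"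
      using alternating_add[of a b k "j - k"] k(2) by (simp add: y_def)
    have b: "alternating a b k @ y \<approx> alternating b a k @ y"
      using eqv_braid[OF k(1)] eqv_append_left by blast
    have "reduced (alternating a b k @ y)" using rx eq by simp
    moreover from this have "reduced (alternating b a k @ y)"
      using len_cong[OF b] by (simp add: reduced_def)
    moreover have "w \<approx> alternating a b k @ y" using wx eq eqv_sym by metis
    moreover from this have "w \<approx> alternating b a k @ y" using b eqv_trans by blast
    moreover have "(a = s \<and> b = t) \<or> (a = t \<and> b = s)" using ab by (auto simp: doubleton_eq_iff)
    moreover have "m s t = enat k" using k(1) calculation(5) m_sym[of s t] by metis
    ultimately show thesis using that by blast
  next
    case 2
    moreover have "{b, a} = {s, t}" using ab by auto
    moreover have "alternating b a (Suc j) @ x' \<approx> w" by (rule eqv_trans[OF 2(2) wx])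
    ultimately have "P (Suc j)" unfolding P_def by blast
    then show thesis using max by fastforce
  qed
qed

text \<open>Reduced words with the same first letter are compared by induction. If the first letters \<open>s \<noteq> t\<close>
  differ, both are descents, and two words that begin with the two sides of a braid relation lie
  between the given ones.\<close>

theorem matsumoto:
  "reduced u \<Longrightarrow> reduced v \<Longrightarrow> u \<approx> v \<Longrightarrow> u \<simeq> v"
proof (induction "length u" arbitrary: u v)
  case 0
  then show ?case using reduced_eqv_length[of u v] by simp
next
  case (Suc n)
  from Suc.prems have len: "length v = Suc n" using Suc.hyps(2) reduced_eqv_length[of u v] by simp
  obtain s u' where u: "u = s # u'" using Suc.hyps(2) by (cases u) auto
  obtain t v' where v: "v = t # v'" using len by (cases v) auto
  have same: "c # x \<simeq> c # y" if "reduced (c # x)" "reduced (c # y)" "c # x \<approx> c # y"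
    "length x = n" for c x y
  proof -
    have "x \<simeq> y" using that reduced_append(2)[of "[c]"] by (intro Suc.hyps(1)) auto
    then show ?thesis using braid_append[of "[c]" "[c]" x y] by simp
  qed
  show ?case
  proof (cases "s = t")
    case True
    then show ?thesis using same[of s u' v'] Suc.prems Suc.hyps(2) u v by simp
  next
    case False
    have desc: "len (c # c # x) < len (c # x)" if "reduced (c # x)" for c x
      using that len_le_eqv[OF eqv_sym[OF eqv_cancel_letter[of "[]" c x]]]
      unfolding reduced_def by simp
    have "len (s # u) < len u" using desc Suc.prems u by blast
    moreover have "len (t # u) < len u"
      using desc[of t v'] Suc.prems v len_cong[of u v] len_cong[of "t # u" "t # v"] by simp
    ultimately obtain k x where k: "m s t = enat k" "u \<approx> alternating s t k @ x" "u \<approx> alternating t s k @ x"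
      "reduced (alternating s t k @ x)" "reduced (alternating t s k @ x)"
      using two_descents[OF Suc.prems(1) False] by metis
    then obtain j where j: "k = Suc j" using m_nonzero[of s t] by (cases k) (auto simp: zero_enat_def)
    have "u \<simeq> alternating s t k @ x"
      using same[of s u' "alternating t s j @ x"] k(2,4) Suc.prems(1) Suc.hyps(2) u j by simp
    also have "\<dots> \<simeq> alternating t s k @ x"
      by (intro braid_append braid_braid False k braid_refl)
    also have "\<dots> \<simeq> v"
    proof -
      have "v \<approx> alternating t s k @ x" using k(3) Suc.prems(3) eqv_sym eqv_trans by blast
      then have "v \<simeq> alternating t s k @ x"
        using same[of t v' "alternating s t j @ x"] k(5) Suc.prems(2) len v j by simp
      then show ?thesis by (rule braid_sym)
    qed
    finally show ?thesis .
  qed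
qed

corollary reduced_set_eq: "reduced u \<Longrightarrow> reduced v \<Longrightarrow> u \<approx> v \<Longrightarrow> set u = set v"
  using matsumoto braid_set by blast

lemma exists_reduced_subset:
  obtains v where "reduced v" "v \<approx> w" "set v \<subseteq> set w"
proof (induction w arbitrary: thesis)
  case Nil
  show ?case by (rule Nil.prems[of "[]"]) (auto simp: reduced_def)
next
  case (Cons s w)
  obtain v where v: "reduced v" "v \<approx> w" "set v \<subseteq> set w" using Cons.IH by blast
  show ?case
  proof (cases "reduced (s # v)")
    case True
    then show ?thesis using v Cons.prems[of "s # v"] by auto
  next
    case False
    then have "len (s # v) < len v" using len_Cons_cases[of s v] v(1) by (auto simp: reduced_def)
    then obtain a c b where ab: "v = a @ c # b" "s # v \<approx> a @ b" by (rule exchange)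
    have "Suc (len (a @ b)) = length (c # a @ b)"
      using len_Cons_cases[of s v] \<open>len (s # v) < len v\<close> len_cong[OF ab(2)] ab(1) v(1)
      by (simp add: reduced_def)
    then have "reduced (a @ b)" by (simp add: reduced_def)
    moreover have "a @ b \<approx> s # w" using ab(2) v(2) by (meson eqv_Cons eqv_sym eqv_trans)
    ultimately show ?thesis using Cons.prems[of "a @ b"] v(3) ab(1) by auto
  qed
qed

lemma reduced_set_subset: "reduced u \<Longrightarrow> u \<approx> v \<Longrightarrow> set u \<subseteq> set v"
  by (metis exists_reduced_subset reduced_set_eq eqv_sym eqv_trans)

end

section \<open>Parabolic cosets and longest elements\<close>

lemma append_eq_append_Cons_cases:
  assumes "u @ v = a @ c # b"
  obtains (left) b' where "u = a @ c # b'" "b = b' @ v"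
    | (right) a' where "a = u @ a'" "v = a' @ c # b"
  using assms by (auto simp: append_eq_append_conv2 append_eq_Cons_conv Cons_eq_append_conv)

context coxeter
begin

definition descent :: "'a list \<Rightarrow> 'a \<Rightarrow> bool" where
  "descent w s \<longleftrightarrow> len (w @ [s]) < len w"

lemma descent_cong: "u \<approx> v \<Longrightarrow> descent u s = descent v s"
  unfolding descent_def using len_cong[OF eqv_append_left, of u v "[s]"] len_cong[of u v] by simp

lemma not_descent_iff: "\<not> descent w s \<longleftrightarrow> len (w @ [s]) = Suc (len w)"
  using len_snoc_cases[of w s] by (auto simp: descent_def)

lemma descent_snoc_swap: "descent (w @ [s]) s \<longleftrightarrow> \<not> descent w s"
proof -
  have "len (w @ [s, s]) = len w" using len_cong[OF eqv_cancel_letter[of w s "[]"]] by simp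
  then show ?thesis using len_snoc_cases[of w s] unfolding descent_def by auto
qed

lemma reduced_snoc_descent: "reduced (w @ [s]) \<Longrightarrow> descent (w @ [s]) s"
  using reduced_append[of w "[s]"] by (auto simp: descent_snoc_swap not_descent_iff reduced_def)

lemma reduced_snoc_iff: "reduced w \<Longrightarrow> reduced (w @ [s]) \<longleftrightarrow> \<not> descent w s"
  by (auto simp: not_descent_iff reduced_def)

definition minimal_in_coset :: "'a set \<Rightarrow> 'a list \<Rightarrow> bool" where
  "minimal_in_coset T x \<longleftrightarrow> (\<forall>y. set y \<subseteq> T \<longrightarrow> len x \<le> len (x @ y))"

text \<open>A deletion that shortens \<open>x @ y\<close> would occur either in \<open>y\<close>, which is reduced, or in \<open>x\<close>, and then
  it would produce a shorter element of the coset of \<open>x\<close>.\<close>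

lemma minimal_additive:
  assumes "minimal_in_coset T x" "set y \<subseteq> T"
  shows "len (x @ y) = len x + len y"
proof -
  obtain x' where x': "reduced x'" "x' \<approx> x" "length x' = len x"
    by (metis exists_reduced)
  obtain y' where y': "reduced y'" "y' \<approx> y" "set y' \<subseteq> T"
    using exists_reduced_subset assms(2) by (metis order_trans)
  have "reduced (x' @ v)" if "reduced v" "set v \<subseteq> T" for v
    using that
  proof (induction v rule: rev_induct)
    case (snoc t v)
    then have v: "reduced v" "reduced (x' @ v)" using reduced_append(1)[of v "[t]"] by auto
    show ?case
    proof (rule ccontr)
      assume "\<not> reduced (x' @ v @ [t])"
      then have "len ((x' @ v) @ [t]) < len (x' @ v)"
        using reduced_snoc_iff[OF v(2), of t] by (simp add: descent_def)
      then obtain a c b where ab: "x' @ v = a @ c # b" "(x' @ v) @ [t] \<approx> a @ b"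
        by (rule exchange_right)
      show False
        using ab(1)
      proof (cases rule: append_eq_append_Cons_cases)
        case b': (left b')
        have "(a @ b') @ v \<approx> x' @ v @ [t]" using eqv_sym[OF ab(2)] b'(2) by simp
        then have "x' @ v @ [t] @ rev v \<approx> a @ b'"
          using eqv_move_right[of "a @ b'" v "x' @ v @ [t]"] eqv_sym by simp
        then have "x @ v @ [t] @ rev v \<approx> a @ b'"
          using eqv_append_left[OF x'(2)] eqv_sym eqv_trans by blast
        then have "len (x @ v @ [t] @ rev v) \<le> length (a @ b')"
          using len_le_eqv eqv_sym by blast
        moreover have "len x \<le> len (x @ v @ [t] @ rev v)"
          using assms(1) snoc.prems(2) unfolding minimal_in_coset_def by simp
        ultimately show False using x'(3) b'(1) by simp
      next
        case a': (right a')
        then have "x' @ (v @ [t]) \<approx> x' @ (a' @ b)" using ab(2) by simp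
        then have "v @ [t] \<approx> a' @ b" by (simp only: eqv_cancel_left)
        then have "len (v @ [t]) \<le> length (a' @ b)" using len_le_eqv eqv_sym by blast
        then show False using snoc.prems(1) a'(2) by (simp add: reduced_def)
      qed
    qed
  qed (use x' in simp)
  then have "len (x' @ y') = length x' + length y'" using y' by (simp add: reduced_def)
  moreover have "len (x' @ y') = len (x @ y)" using eqv_append x'(2) y'(2) len_cong by blast
  moreover have "length y' = len y" using y'(1,2) len_cong reduced_def by metis
  ultimately show ?thesis using x'(3) by simp
qed

lemma coset_decomposition:
  obtains z y where "minimal_in_coset T z" "reduced y" "set y \<subseteq> T" "w \<approx> z @ y" "len w = len z + length y"
proof -
  \<comment> \<open>Multiplying by some \<open>v\<close> over \<open>T\<close> leads to an element of minimal length in the coset.\<close>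
  define A where "A = {n. \<exists>v. set v \<subseteq> T \<and> len (w @ v) = n}"
  have "len w \<in> A" unfolding A_def by (auto intro: exI[of _ "[]"])
  then have "(LEAST n. n \<in> A) \<in> A" by (rule LeastI)
  then obtain v where v: "set v \<subseteq> T" "len (w @ v) = (LEAST n. n \<in> A)"
    unfolding A_def by auto
  have min: "minimal_in_coset T (w @ v)"
    unfolding minimal_in_coset_def
  proof safe
    fix y assume "set y \<subseteq> T"
    then have "len (w @ (v @ y)) \<in> A" using v(1) unfolding A_def by (auto intro!: exI[of _ "v @ y"])
    then show "len (w @ v) \<le> len ((w @ v) @ y)" unfolding v(2) by (simp add: Least_le)
  qed
  obtain y where y: "reduced y" "y \<approx> rev v" "set y \<subseteq> T"
    using exists_reduced_subset[of "rev v"] v(1) by (metis order_trans set_rev)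
  have "(w @ v) @ y \<approx> (w @ v) @ rev v" using y(2) by (rule eqv_append_right)
  also have "(w @ v) @ rev v \<approx> w" using eqv_append_right[OF eqv_rev_right, of w v] by simp
  finally have eq: "(w @ v) @ y \<approx> w" .
  then have "len w = len (w @ v) + length y"
    using minimal_additive[OF min y(3)] len_cong y(1) by (simp add: reduced_def)
  then show thesis using that min y eq eqv_sym by blast
qed

lemma minimal_iff_no_descent: "minimal_in_coset T x \<longleftrightarrow> (\<forall>t\<in>T. \<not> descent x t)"
proof safe
  fix t assume "minimal_in_coset T x" "t \<in> T" "descent x t"
  then show False unfolding minimal_in_coset_def descent_def
    by (auto dest!: spec[of _ "[t]"])
next
  assume nd: "\<forall>t\<in>T. \<not> descent x t"
  obtain z y where zy: "minimal_in_coset T z" "reduced y" "set y \<subseteq> T" "x \<approx> z @ y" "len x = len z + length y"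
    by (rule coset_decomposition)
  have "y = []"
  proof (rule ccontr)
    assume "y \<noteq> []"
    then obtain y' t where y': "y = y' @ [t]" by (metis rev_exhaust)
    have "len (z @ y') = len z + len y'" using minimal_additive[OF zy(1), of y'] zy(3) y' by simp
    moreover have "len y' = length y'" using zy(2) y' reduced_append(1) unfolding reduced_def by blast
    ultimately have "len (z @ y') = len z + length y'" by simp
    then have "\<not> descent (z @ y') t"
      using zy(4,5) y' len_cong[OF zy(4)] by (simp add: not_descent_iff)
    then have "descent ((z @ y') @ [t]) t" by (simp only: descent_snoc_swap) simp
    then have "descent x t" using descent_cong[OF zy(4)] y' by simp
    then show False using nd zy(3) y' by simp
  qed
  then have "x \<approx> z" using zy(4) by simp
  then show "minimal_in_coset T x"
    using zy(1) len_cong[of x z] len_cong[OF eqv_append_left, of x z]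
    unfolding minimal_in_coset_def by simp
qed

corollary no_descent_additive:
  "(\<And>t. t \<in> T \<Longrightarrow> \<not> descent x t) \<Longrightarrow> set y \<subseteq> T \<Longrightarrow> len (x @ y) = len x + len y"
  using minimal_additive minimal_iff_no_descent by blast

text \<open>A reduced word of the longest element of the parabolic subgroup of \<open>T\<close>, characterised by its
  descents; it exists exactly if the subgroup is finite, provided that \<open>T\<close> is.\<close>

definition longest :: "'a set \<Rightarrow> 'a list \<Rightarrow> bool" where
  "longest T y \<longleftrightarrow> reduced y \<and> set y \<subseteq> T \<and> (\<forall>t\<in>T. descent y t)"

text \<open>Induction on \<open>v\<close>: if the next letter \<open>t\<close> is a descent of \<open>z @ v\<close>, the exchange condition cannot
  delete a letter of \<open>v\<close>, since \<open>v @ [t]\<close> is reduced, so it deletes one of \<open>z\<close>.\<close>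

lemma all_descents_suffix:
  assumes "\<forall>t\<in>T. descent y t" "reduced v" "set v \<subseteq> T"
  shows "\<exists>z. y \<approx> z @ v \<and> len y = len z + length v"
  using assms(2,3)
proof (induction v rule: rev_induct)
  case (snoc t v)
  have v: "reduced v" "set v \<subseteq> T" using snoc.prems reduced_append(1)[of v "[t]"] by auto
  obtain z0 where z0: "y \<approx> z0 @ v" "len y = len z0 + length v" using snoc.IH[OF v] by blast
  obtain z where z: "z \<approx> z0" "length z = len z0" by (metis exists_reduced)
  have y: "y \<approx> z @ v" using z0(1) z(1) eqv_append_left eqv_sym eqv_trans by blast
  have "descent (z @ v) t" using assms(1) snoc.prems(2) descent_cong[OF y] by simp
  then have "len ((z @ v) @ [t]) < len (z @ v)" by (simp add: descent_def)
  then obtain a c b where ab: "z @ v = a @ c # b" "(z @ v) @ [t] \<approx> a @ b"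
    by (rule exchange_right)
  show ?case
    using ab(1)
  proof (cases rule: append_eq_append_Cons_cases)
    case b': (left b')
    have "z @ v \<approx> (a @ b') @ (v @ [t])"
      using eqv_move_right[of "z @ v" "[t]"] ab(2) b'(2) by simp
    then have *: "y \<approx> (a @ b') @ (v @ [t])" using y eqv_trans by blast
    have "len y \<le> len (a @ b') + length (v @ [t])"
      using len_append[of "a @ b'" "v @ [t]"] len_cong[OF *] len_le_length[of "v @ [t]"] by linarith
    moreover have "len (a @ b') \<le> length (a @ b')" by (rule len_le_length)
    ultimately have "len y = len (a @ b') + length (v @ [t])" using z0(2) z(2) b'(1) by simp
    then show ?thesis using * by blast
  next
    case a': (right a')
    then have "z @ (v @ [t]) \<approx> z @ (a' @ b)" using ab(2) by simp
    then have "v @ [t] \<approx> a' @ b" by (simp only: eqv_cancel_left)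
    then have "len (v @ [t]) \<le> length (a' @ b)" using len_le_eqv eqv_sym by blast
    then show ?thesis using snoc.prems(1) a'(2) by (simp add: reduced_def)
  qed
qed (auto)

lemma all_descents_bound:
  assumes "\<forall>t\<in>T. descent y t" "set v \<subseteq> T"
  shows "len v \<le> len y"
proof -
  obtain v' where v': "reduced v'" "v' \<approx> v" "set v' \<subseteq> T"
    using exists_reduced_subset assms(2) by (metis order_trans)
  then have "length v' \<le> len y" using all_descents_suffix[OF assms(1)] by fastforce
  then show ?thesis using v' len_cong reduced_def by metis
qed

text \<open>The reverse of \<open>y\<close> is a suffix of \<open>y\<close> of the same length. So the longest element is an involution
  and its left descents are its right descents.\<close>

lemma longest_rev:
  assumes "longest T y"
  shows "y \<approx> rev y"
proof -
  obtain z where z: "y \<approx> z @ rev y" "len y = len z + length (rev y)"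
    using all_descents_suffix[of T y "rev y"] assms unfolding longest_def by (auto simp: reduced_rev)
  then have "z \<approx> []" using assms len_eq_0 by (simp add: longest_def reduced_def)
  then have "z @ rev y \<approx> rev y" using eqv_append_left[of z "[]" "rev y"] by simp
  then show ?thesis by (rule eqv_trans[OF z(1)])
qed

lemma longest_square: "longest T y \<Longrightarrow> y @ y \<approx> []"
  by (rule eqv_trans[OF eqv_append_right[OF longest_rev] eqv_rev_right])

lemma longest_left:
  assumes "longest T y" "t \<in> T"
  obtains y' where "y \<approx> t # y'" "reduced (t # y')"
proof -
  have "descent y t" using assms by (simp add: longest_def)
  then have "descent (rev y) t" using descent_cong[OF longest_rev[OF assms(1)]] by simp
  then have "len (t # y) < len y" by (simp add: descent_def len_snoc_rev)
  then obtain a c b where ab: "y = a @ c # b" "t # y \<approx> a @ b" by (rule exchange)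
  then have "y \<approx> t # a @ b" using eqv_move_letter by blast
  moreover from this have "reduced (t # a @ b)"
    using assms(1) ab(1) len_cong[of y "t # a @ b"] by (simp add: longest_def reduced_def)
  ultimately show thesis using that by blast
qed

lemma bounded_imp_longest:
  assumes "\<And>v. set v \<subseteq> T \<Longrightarrow> len v \<le> N"
  shows "\<exists>y. longest T y"
proof -
  have "\<exists>y. set y \<subseteq> T \<and> (\<forall>v. set v \<subseteq> T \<longrightarrow> len v \<le> len y)"
    using ex_has_greatest_nat[of "\<lambda>v. set v \<subseteq> T" "[]" len "Suc N"] assms
    by (auto simp: less_Suc_eq_le)
  then obtain y0 where y0: "set y0 \<subseteq> T" "\<And>v. set v \<subseteq> T \<Longrightarrow> len v \<le> len y0" by blast
  obtain y where y: "reduced y" "y \<approx> y0" "set y \<subseteq> T"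
    using exists_reduced_subset y0(1) by (metis order_trans)
  have "descent y t" if "t \<in> T" for t
  proof (rule ccontr)
    assume "\<not> descent y t"
    then have "len (y @ [t]) = Suc (len y0)" using len_cong[OF y(2)] by (simp add: not_descent_iff)
    moreover have "len (y @ [t]) \<le> len y0" using y(3) that by (intro y0(2)) auto
    ultimately show False by simp
  qed
  then show ?thesis using y unfolding longest_def by blast
qed

text \<open>The bridge from the descents of a single element, wherever it lies in the group, to the
  finiteness of a parabolic subgroup.\<close>

lemma all_descents_imp_longest: "\<forall>t\<in>T. descent w t \<Longrightarrow> \<exists>y. longest T y"
  by (rule bounded_imp_longest[OF all_descents_bound])

end

section \<open>From words to presentations\<close>

definition positive :: "'a list \<Rightarrow> 'a word" where
  "positive w = map (\<lambda>s. (s, True)) w"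

lemma positive_simps [simp]: "positive [] = []" "positive (s # w) = (s, True) # positive w"
  "positive (u @ v) = positive u @ positive v" "map fst (positive w) = w"
  "length (positive w) = length w"
  by (simp_all add: positive_def comp_def)

lemma positive_words [simp]: "positive w \<in> words S \<longleftrightarrow> set w \<subseteq> S"
  by (auto simp: positive_def)

lemma positive_alternating: "positive (alternating s t k) = alternating (s, True) (t, True) k"
  by (simp add: positive_def map_alternating)

text \<open>The homomorphism from the Artin-Tits group to the integers that maps every generator to \<open>1\<close>. On
  positive words it is the length, so the length is preserved by equality in the group.\<close>

definition exponent_sum :: "'a word \<Rightarrow> int" where
  "exponent_sum x = (\<Sum>(s, b)\<leftarrow>x. if b then 1 else - 1)"

lemma exponent_sum_positive: "exponent_sum (positive w) = int (length w)"
  by (induction w) (auto simp: exponent_sum_def)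

lemma pres_cong_exponent_sum:
  "pres_cong S (artin_relations S m) x y \<Longrightarrow> exponent_sum x = exponent_sum y"
proof (induction rule: pres_cong.induct)
  case (rel x y)
  then show ?case
    by (auto simp: artin_relations_def positive_alternating[symmetric] exponent_sum_positive
          simp del: alternating_Suc)
qed (auto simp: exponent_sum_def)

lemma pres_cong_Cons:
  "s \<in> S \<Longrightarrow> pres_cong S R x y \<Longrightarrow> pres_cong S R ((s, b) # x) ((s, b) # y)"
  using pres_cong.append[OF pres_cong.refl[of "[(s, b)]"]] by fastforce

lemma coxeter_square: "s \<in> S \<Longrightarrow> pres_cong S (coxeter_relations S m) [(s, True), (s, True)] []"
  by (rule pres_cong.rel) (auto simp: coxeter_relations_def)

lemma pres_cong_coxeter_positive:
  "x \<in> words S \<Longrightarrow> pres_cong S (coxeter_relations S m) x (positive (map fst x))"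
proof (induction x)
  case (Cons a x)
  let ?R = "coxeter_relations S m"
  obtain s b where a: "a = (s, b)" by force
  have s: "s \<in> S" using Cons.prems a by auto
  have IH: "pres_cong S ?R x (positive (map fst x))" using Cons by simp
  have "pres_cong S ?R [(s, b)] [(s, True)]"
  proof (cases b)
    case False
    have "pres_cong S ?R ([(s, True), (s, True)] @ [(s, False)]) ([] @ [(s, False)])"
      using s by (intro pres_cong.append coxeter_square pres_cong.refl) auto
    moreover have "pres_cong S ?R ((s, True) # [(s, True), (s, \<not> True)]) ((s, True) # [])"
      using s by (intro pres_cong_Cons pres_cong.cancel)
    ultimately show ?thesis using False pres_cong.sym pres_cong.trans by fastforce
  qed (use s in \<open>auto intro!: pres_cong.refl\<close>)
  from pres_cong.append[OF this IH] show ?case by (simp add: a)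
qed (auto intro: pres_cong.refl)

context coxeter
begin

lemma pres_cong_imp_eqv:
  "pres_cong T (coxeter_relations T m) x y \<Longrightarrow> map fst x \<approx> map fst y"
proof (induction rule: pres_cong.induct)
  case (rel x y)
  then show ?case
    by (auto simp: coxeter_relations_def artin_relations_def map_alternating
          intro: eqv_braid eqv_square)
qed (auto intro: eqv.intros)

lemma artin_cong_imp_eqv:
  assumes "pres_cong T (artin_relations T m) (positive u) (positive v)"
  shows "u \<approx> v" "length u = length v"
  using pres_cong_imp_eqv[OF pres_cong_mono[OF assms]] pres_cong_exponent_sum[OF assms]
  by (auto simp: coxeter_relations_def exponent_sum_positive)

text \<open>Braid moves do not change the set of letters, so a sequence of them that starts over \<open>T\<close> never
  leaves \<open>T\<close>.\<close>

lemma braid_imp_artin_cong: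
  "u \<simeq> v \<Longrightarrow> set u \<subseteq> T \<Longrightarrow> pres_cong T (artin_relations T m) (positive u) (positive v)"
proof (induction rule: braid_eqv.induct)
  case (braid_refl w)
  then show ?case by (intro pres_cong.refl) simp
next
  case (braid_sym u v)
  then show ?case using braid_set pres_cong.sym by metis
next
  case (braid_trans u v w)
  then show ?case using braid_set pres_cong.trans by metis
next
  case (braid_append u v u' v')
  then show ?case using pres_cong.append by fastforce
next
  case (braid_braid s t k)
  then obtain j where "k = Suc (Suc j)"
    by (metis m_ge_2 add_2_eq_Suc le_Suc_ex)
  then have st: "s \<in> T" "t \<in> T" using braid_braid.prems by auto
  show ?case
  proof (rule pres_cong.rel)
    show "(positive (alternating s t k), positive (alternating t s k)) \<in> artin_relations T m"
      unfolding positive_alternating artin_relations_def using st braid_braid.hyps by auto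
  qed (use st set_alternating[of s t k] set_alternating[of t s k] in auto)
qed

corollary reduced_artin_cong:
  "reduced u \<Longrightarrow> reduced v \<Longrightarrow> u \<approx> v \<Longrightarrow> set u \<subseteq> T
    \<Longrightarrow> pres_cong T (artin_relations T m) (positive u) (positive v)"
  by (intro braid_imp_artin_cong matsumoto)

lemma artin_imp_coxeter_cong:
  "pres_cong T (artin_relations T m) x y \<Longrightarrow> pres_cong T (coxeter_relations T m) x y"
  by (erule pres_cong_mono) (simp add: coxeter_relations_def)

text \<open>A word over \<open>T\<close> can be reduced by the relations of \<open>T\<close> alone: a letter that shortens a reduced
  word is brought to its front by braid moves and then cancelled.\<close>

lemma exists_reduced_pres:
  assumes "set w \<subseteq> T"
  obtains v where "reduced v" "set v \<subseteq> T"
    "pres_cong T (coxeter_relations T m) (positive w) (positive v)"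
  using assms
proof (induction w arbitrary: thesis)
  case Nil
  show ?case by (rule Nil.prems(1)[of "[]"]) (auto simp: reduced_def intro: pres_cong.refl)
next
  case (Cons s w)
  let ?R = "coxeter_relations T m"
  have s: "s \<in> T" using Cons.prems(2) by simp
  obtain v where v: "reduced v" "set v \<subseteq> T" "pres_cong T ?R (positive w) (positive v)"
    using Cons.IH Cons.prems(2) by (metis set_subset_Cons subset_trans)
  have sv: "pres_cong T ?R (positive (s # w)) (positive (s # v))"
    using pres_cong_Cons[OF s v(3)] by simp
  show ?case
  proof (cases "reduced (s # v)")
    case True
    then show ?thesis using v(2) s sv by (intro Cons.prems(1)[of "s # v"]) auto
  next
    case False
    obtain y where y: "reduced y" "y \<approx> s # v" by (metis exists_reduced)
    have red: "reduced (s # y)"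
    proof -
      have "Suc (len (s # v)) = len v"
        using False len_Cons_cases[of s v] v(1) by (auto simp: reduced_def)
      then have "Suc (len y) = len v" using len_cong[OF y(2)] by simp
      moreover have "s # y \<approx> v" using y(2) eqv_move_letter by blast
      ultimately show ?thesis using y(1) len_cong[of "s # y" v] by (simp add: reduced_def)
    qed
    have sy: "v \<approx> s # y" using y(2) eqv_move_letter eqv_sym by blast
    then have "set y \<subseteq> T" using reduced_set_eq[OF v(1) red sy] v(2) by auto
    have "pres_cong T ?R (positive (s # v)) (positive (s # s # y))"
      using pres_cong_Cons[OF s artin_imp_coxeter_cong[OF reduced_artin_cong[OF v(1) red sy v(2)]]]
      by simp
    moreover have "pres_cong T ?R ([(s, True), (s, True)] @ positive y) ([] @ positive y)"
      using s \<open>set y \<subseteq> T\<close> by (intro pres_cong.append coxeter_square pres_cong.refl) auto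
    ultimately have "pres_cong T ?R (positive (s # w)) (positive y)"
      using sv pres_cong.trans by (metis append_Cons append_Nil positive_simps(2))
    then show ?thesis using y(1) \<open>set y \<subseteq> T\<close> Cons.prems(1) by blast
  qed
qed

text \<open>So the Coxeter group presented on \<open>T\<close> embeds into the one on all letters: both words can be reduced
  by the relations of \<open>T\<close>, and then they are related by braid moves over \<open>T\<close>.\<close>

theorem parabolic_injective:
  assumes "set u \<subseteq> T" "set v \<subseteq> T" "u \<approx> v"
  shows "pres_cong T (coxeter_relations T m) (positive u) (positive v)"
proof -
  let ?R = "coxeter_relations T m"
  obtain u' where u': "reduced u'" "set u' \<subseteq> T" "pres_cong T ?R (positive u) (positive u')"
    using exists_reduced_pres assms(1) by blast
  obtain v' where v': "reduced v'" "set v' \<subseteq> T" "pres_cong T ?R (positive v) (positive v')"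
    using exists_reduced_pres assms(2) by blast
  have "u \<approx> u'" "v \<approx> v'" using pres_cong_imp_eqv u'(3) v'(3) by fastforce+
  then have "u' \<approx> v'" using assms(3) eqv_sym eqv_trans by blast
  then have "pres_cong T ?R (positive u') (positive v')"
    using u' v' reduced_artin_cong artin_imp_coxeter_cong by blast
  then show ?thesis using u'(3) v'(3) pres_cong.sym pres_cong.trans by metis
qed

lemma spherical_imp_longest:
  assumes "spherical m T"
  shows "\<exists>y. longest T y"
proof -
  let ?cl = "\<lambda>x. pres_rel T (coxeter_relations T m) `` {x}"
  let ?len = "\<lambda>X. len (map fst (SOME x. x \<in> X))"
  let ?C = "carrier (coxeter_group T m)"
  have fin: "finite (?len ` ?C)" using assms unfolding spherical_def by simp
  show ?thesis
  proof (rule bounded_imp_longest)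
    fix v assume "set v \<subseteq> T"
    then have v: "positive v \<in> words T" by simp
    then have "positive v \<in> ?cl (positive v)" by (simp add: pres_rel_def pres_cong.refl)
    then have "(SOME x. x \<in> ?cl (positive v)) \<in> ?cl (positive v)" by (rule someI)
    then have "?len (?cl (positive v)) = len v"
      using pres_cong_imp_eqv len_cong by (fastforce simp: pres_rel_def)
    moreover have "?cl (positive v) \<in> ?C"
      unfolding coxeter_group_def by (rule pres_class_in_carrier[OF v])
    ultimately show "len v \<le> Max (?len ` ?C)" using fin by (intro Max_ge) force+
  qed
qed

lemma longest_imp_spherical:
  assumes "longest T y" "finite T"
  shows "spherical m T"
proof -
  let ?cl = "\<lambda>x. pres_rel T (coxeter_relations T m) `` {x}"
  let ?L = "{v. set v \<subseteq> T \<and> length v \<le> len y}"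
  have "carrier (coxeter_group T m) \<subseteq> (\<lambda>v. ?cl (positive v)) ` ?L"
  proof
    fix X assume "X \<in> carrier (coxeter_group T m)"
    then obtain x where x: "x \<in> words T" "X = ?cl x"
      unfolding coxeter_group_def by (rule pres_carrierE)
    then have "set (map fst x) \<subseteq> T" by auto
    then obtain v where v: "reduced v" "set v \<subseteq> T"
      "pres_cong T (coxeter_relations T m) (positive (map fst x)) (positive v)"
      by (rule exists_reduced_pres)
    have "X = ?cl (positive v)"
      using x v pres_cong.trans[OF pres_cong_coxeter_positive[OF x(1)] v(3)]
      by (simp add: pres_class_eq_iff del: in_lists_conv_set)
    moreover have "length v \<le> len y"
      using all_descents_bound[of T y v] v(1,2) assms(1) by (simp add: longest_def reduced_def)
    ultimately show "X \<in> (\<lambda>v. ?cl (positive v)) ` ?L" using v(2) by blast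
  qed
  then show ?thesis
    unfolding spherical_def using finite_lists_length_le[OF assms(2)] finite_surj by blast
qed

section \<open>The Hecke representation of the Artin-Tits group\<close>

lemma reduced_alternating_le:
  assumes "s \<noteq> t" "m s t = enat k" "n \<le> k"
  shows "reduced (alternating s t n)"
  using assms
proof (induction n arbitrary: s t)
  case (Suc n)
  have red: "reduced (alternating t s n)" using Suc m_sym[of s t] by auto
  show ?case
  proof (rule ccontr)
    assume "\<not> reduced (alternating s t (Suc n))"
    then have *: "len (s # alternating t s n @ []) < len (alternating t s n @ [])"
      using red len_Cons_cases[of s "alternating t s n"] by (auto simp: reduced_def)
    then have n: "n > 0" by (cases n) auto
    consider "alternating t s n \<approx> alternating s t n"
      | x' where "reduced (alternating s t (Suc n) @ x')"
          "alternating s t (Suc n) @ x' \<approx> alternating t s n @ []"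
      using alternating_prefix_extend[of t s n "[]" , OF _ n *] red by auto
    then show False
    proof cases
      case 1
      then show ?thesis using dihedral_order[of t s n] Suc.prems m_sym[of s t] n by force
    next
      case 2
      then have "length (alternating s t (Suc n) @ x') = length (alternating t s n @ [])"
        using red by (intro reduced_eqv_length) auto
      then show ?thesis by simp
    qed
  qed
qed (simp add: reduced_def)

text \<open>The generator of the Hecke algebra at the parameter \<open>2\<close>, acting on functions on the Coxeter
  group. As the parameter exceeds \<open>1\<close>, nonnegative functions stay nonnegative; as it is invertible, so
  are the operators, and they represent the whole Artin-Tits group. Divisibility between positive
  elements of the group thus becomes visible in the supports of functions.\<close>

definition hecke :: "'a \<Rightarrow> ('a list \<Rightarrow> real) \<Rightarrow> 'a list \<Rightarrow> real" where
  "hecke t F w = (if len (t # w) > len w then F (t # w) else 2 * F (t # w) + F w)"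

definition hecke_inv :: "'a \<Rightarrow> ('a list \<Rightarrow> real) \<Rightarrow> 'a list \<Rightarrow> real" where
  "hecke_inv t F w = (hecke t F w - F w) / 2"

text \<open>Functions on the Coxeter group, as functions on words.\<close>

definition invariant :: "('a list \<Rightarrow> real) \<Rightarrow> bool" where
  "invariant F \<longleftrightarrow> (\<forall>u v. u \<approx> v \<longrightarrow> F u = F v)"

lemma invariantD: "invariant F \<Longrightarrow> u \<approx> v \<Longrightarrow> F u = F v"
  by (simp add: invariant_def)

lemma invariant_hecke: "invariant F \<Longrightarrow> invariant (hecke t F)"
  unfolding invariant_def hecke_def
proof (intro allI impI)
  fix u v assume F: "\<forall>u v. u \<approx> v \<longrightarrow> F u = F v" and uv: "u \<approx> v"
  have "F u = F v" "F (t # u) = F (t # v)" using F uv eqv_Cons by blast+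
  moreover have "len u = len v" "len (t # u) = len (t # v)"
    using uv eqv_Cons len_cong by blast+
  ultimately show "(if len u < len (t # u) then F (t # u) else 2 * F (t # u) + F u)
    = (if len v < len (t # v) then F (t # v) else 2 * F (t # v) + F v)" by simp
qed

lemma invariant_hecke_inv: "invariant F \<Longrightarrow> invariant (hecke_inv t F)"
  using invariant_hecke[of F t] unfolding invariant_def hecke_inv_def by metis

lemma hecke_square:
  assumes "invariant F"
  shows "hecke t (hecke t F) w = 2 * F w + hecke t F w"
proof -
  have "len (t # t # w) = len w" "F (t # t # w) = F w"
    using eqv_cancel_letter[of "[]" t w] len_cong[of "t # t # w" w] invariantD[OF assms, of "t # t # w" w] by auto
  then show ?thesis
    using len_Cons_cases[of t w] hecke_def[of t F w] hecke_def[of t F "t # w"]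
      hecke_def[of t "hecke t F" w] by (cases "len (t # w) > len w") auto
qed

lemma hecke_linear: "hecke t (\<lambda>w. a * F w + b * G w) w = a * hecke t F w + b * hecke t G w"
  by (simp add: hecke_def algebra_simps)

lemma hecke_hecke_inv:
  assumes "invariant F"
  shows "hecke t (hecke_inv t F) = F" "hecke_inv t (hecke t F) = F"
proof -
  have "hecke_inv t F = (\<lambda>w. (1/2) * hecke t F w + (- 1/2) * F w)"
    by (auto simp: hecke_inv_def)
  then have "hecke t (hecke_inv t F) w = F w" for w
    using hecke_square[OF assms, of t w] by (simp only: hecke_linear) (simp add: field_simps)
  then show "hecke t (hecke_inv t F) = F" by blast
  show "hecke_inv t (hecke t F) = F"
    using hecke_square[OF assms, of t] by (auto simp: hecke_inv_def)
qed

primrec heckes :: "'a list \<Rightarrow> ('a list \<Rightarrow> real) \<Rightarrow> 'a list \<Rightarrow> real" where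
  "heckes [] F = F"
| "heckes (t # w) F = hecke t (heckes w F)"

lemma heckes_append [simp]: "heckes (u @ v) F = heckes u (heckes v F)"
  by (induction u) auto

lemma invariant_heckes: "invariant F \<Longrightarrow> invariant (heckes w F)"
  by (induction w) (auto intro: invariant_hecke)

lemma heckes_linear:
  "heckes u (\<lambda>w. a * F w + b * G w) = (\<lambda>w. a * heckes u F w + b * heckes u G w)"
  by (induction u) (auto simp: hecke_linear)

lemma heckes_additive:
  "len (rev u @ v) = length u + len v \<Longrightarrow> heckes u F v = F (rev u @ v)"
proof (induction u arbitrary: v)
  case (Cons a u)
  have "len (rev u @ a # v) \<le> length u + len (a # v)"
    using len_append[of "rev u" "a # v"] len_le_length[of "rev u"] by simp
  then have a: "len (a # v) = Suc (len v)"
    using Cons.prems len_Cons_le[of a v] by simp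
  then have "heckes u F (a # v) = F (rev u @ a # v)"
    using Cons.prems by (intro Cons.IH) simp
  then show ?case using a by (simp add: hecke_def)
qed simp

text \<open>If neither \<open>s\<close> nor \<open>t\<close> shortens \<open>w\<close>, both sides evaluate \<open>F\<close> at the product of the longest
  element of the dihedral group and \<open>w\<close>. If \<open>a \<in> {s, t}\<close> shortens \<open>w\<close>, the value at \<open>w\<close> is the value of one
  more operator at \<open>a # w\<close>, and the quadratic relation reduces the claim to the claim at \<open>a # w\<close>.\<close>

lemma heckes_braid:
  assumes st: "s \<noteq> t" and k: "m s t = enat k" and F: "invariant F"
  shows "heckes (alternating s t k) F w = heckes (alternating t s k) F w"
  using F
proof (induction "len w" arbitrary: w F rule: less_induct)
  case less
  have k': "m t s = enat k" using k m_sym by metis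
  note F = less.prems
  have step: "heckes (alternating a b k) F w = heckes (alternating b a k) F w"
    if ab: "{a, b} = {s, t}" and desc: "len (a # w) < len w" for a b
  proof -
    \<comment> \<open>The common last letter of \<open>alternating a b (Suc k)\<close> and \<open>alternating b a k\<close>.\<close>
    let ?c = "if even k then a else b"
    let ?w = "a # w"
    obtain j where j: "k = Suc j" using k m_nonzero[of s t] by (cases k) (auto simp: zero_enat_def)
    have eq: "heckes (alternating s t k) G ?w = heckes (alternating t s k) G ?w" if "invariant G" for G
      using less.hyps[OF desc that] .
    have swap: "heckes (alternating a b k) G ?w = heckes (alternating b a k) G ?w"
      if "invariant G" for G
    proof -
      have "(a = s \<and> b = t) \<or> (a = t \<and> b = s)" using ab by (auto simp: doubleton_eq_iff)
      then show ?thesis using eq[OF that] by metis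
    qed
    \<comment> \<open>The letter \<open>a\<close> lengthens \<open>a # w\<close> to \<open>w\<close>, so moving from \<open>w\<close> to \<open>a # w\<close> costs one operator.\<close>
    have up: "G w = hecke a G ?w" if "invariant G" for G
    proof -
      have "a # a # w \<approx> w" using eqv_cancel_letter[of "[]"] by simp
      then have "len (a # a # w) = len w" "G (a # a # w) = G w"
        using len_cong invariantD[OF that] by blast+
      then show ?thesis using desc by (simp add: hecke_def)
    qed
    have "a # alternating b a k = alternating a b (Suc k)" by simp
    also have "\<dots> = alternating a b k @ [?c]" by (rule alternating_snoc)
    finally have "heckes (alternating b a k) F w = heckes (alternating a b k @ [?c]) F ?w"
      using up[OF invariant_heckes[OF F]] by (metis heckes.simps(2))
    also have "\<dots> = heckes (alternating b a k) (hecke ?c F) ?w"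
      using swap[OF invariant_hecke[OF F]] by simp
    also have "alternating b a k = alternating b a j @ [?c]"
      unfolding j alternating_snoc by simp
    also have "heckes \<dots> (hecke ?c F) ?w = heckes (alternating b a j) (hecke ?c (hecke ?c F)) ?w"
      by simp
    also have "hecke ?c (hecke ?c F) = (\<lambda>w. 2 * F w + 1 * hecke ?c F w)"
      using hecke_square[OF F] by auto
    also have "heckes (alternating b a j) \<dots> ?w
        = 2 * heckes (alternating b a j) F ?w + heckes (alternating b a j @ [?c]) F ?w"
      by (subst heckes_linear) simp
    also have "alternating b a j @ [?c] = alternating b a k"
      unfolding j alternating_snoc by simp
    also have "heckes (alternating b a k) F ?w = heckes (alternating a b k) F ?w"
      using swap[OF F] by simp
    also have "2 * heckes (alternating b a j) F ?w + heckes (alternating a b k) F ?w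
        = hecke a (hecke a (heckes (alternating b a j) F)) ?w"
      using hecke_square[OF invariant_heckes[OF F]] j by simp
    also have "\<dots> = heckes (alternating a b k) F w"
      using up[OF invariant_heckes[OF F, of "alternating a b k"]] j by simp
    finally show ?thesis by simp
  qed
  consider "len (s # w) < len w" | "len (t # w) < len w"
    | "len (s # w) > len w" "len (t # w) > len w"
    using len_Cons_cases[of s w] len_Cons_cases[of t w] by linarith
  then show ?case
  proof cases
    case 1
    then show ?thesis using step[of s t] by simp
  next
    case 2
    have "{t, s} = {s, t}" by auto
    from step[OF this 2] show ?thesis by simp
  next
    case 3
    have base: "heckes u F w = F (rev u @ w)" if "reduced u" "set u \<subseteq> {s, t}" for u
    proof (rule heckes_additive)
      have "len (rev w @ u) = len (rev w) + len u"
        using 3 that(2) by (intro no_descent_additive[of "{s, t}"]) (auto simp: descent_def len_snoc_rev)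
      moreover have "len (rev u @ w) = len (rev w @ u)"
        using len_rev[of "rev w @ u"] by simp
      ultimately show "len (rev u @ w) = length u + len w"
        using that(1) by (simp add: reduced_def)
    qed
    have "rev (alternating s t k) @ w \<approx> rev (alternating t s k) @ w"
      by (intro eqv_append_left eqv_rev eqv_braid k)
    then have "F (rev (alternating s t k) @ w) = F (rev (alternating t s k) @ w)"
      by (rule invariantD[OF F])
    moreover have "reduced (alternating s t k)" "reduced (alternating t s k)"
      using reduced_alternating_le st k k' by auto
    ultimately show ?thesis
      using base set_alternating[of s t k] set_alternating[of t s k] by (simp add: insert_commute)
  qed
qed

definition hecke_letter :: "'a \<times> bool \<Rightarrow> ('a list \<Rightarrow> real) \<Rightarrow> 'a list \<Rightarrow> real" where
  "hecke_letter a = (if snd a then hecke (fst a) else hecke_inv (fst a))"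

lemma invariant_hecke_word: "invariant F \<Longrightarrow> invariant (foldr hecke_letter x F)"
  by (induction x) (auto simp: hecke_letter_def intro: invariant_hecke invariant_hecke_inv)

lemma hecke_word_positive: "foldr hecke_letter (positive w) F = heckes w F"
  by (induction w) (auto simp: hecke_letter_def)

lemma hecke_word_cong:
  "pres_cong T (artin_relations T m) x y \<Longrightarrow> invariant F
    \<Longrightarrow> foldr hecke_letter x F = foldr hecke_letter y F"
proof (induction arbitrary: F rule: pres_cong.induct)
  case (append x y x' y')
  show ?case using append.IH(1)[OF invariant_hecke_word[OF append.prems]] append.IH(2)[OF append.prems]
    by simp
next
  case (cancel s b)
  then show ?case by (cases b) (auto simp: hecke_letter_def hecke_hecke_inv)
next
  case (rel x y)
  then obtain s t k where "s \<noteq> t" "m s t = enat k"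
    "x = positive (alternating s t k)" "y = positive (alternating t s k)"
    by (auto simp: artin_relations_def positive_alternating)
  moreover from this have "heckes (alternating s t k) F = heckes (alternating t s k) F"
    using heckes_braid rel.prems by blast
  ultimately show ?case by (simp add: hecke_word_positive)
next
  case (sym x y)
  then show ?case using sym.IH[OF sym.prems] by simp
next
  case (trans x y z)
  then show ?case using trans.IH(1)[OF trans.prems] trans.IH(2)[OF trans.prems] by simp
qed simp

lemma heckes_nonneg:
  assumes "\<And>w. F w \<ge> 0"
  shows "heckes u F w \<ge> 0"
  by (induction u arbitrary: w) (simp_all add: hecke_def assms)

lemma hecke_pos:
  assumes "invariant F" "\<And>w. F w \<ge> 0" "F w > 0"
  shows "len (t # w) < len w \<Longrightarrow> hecke t F w > 0" "len (t # w) > len w \<Longrightarrow> hecke t F (t # w) > 0"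
proof -
  have "len (t # t # w) = len w" "F (t # t # w) = F w"
    using eqv_cancel_letter[of "[]" t w] len_cong[of "t # t # w" w] invariantD[OF assms(1), of "t # t # w" w] by auto
  then show "len (t # w) < len w \<Longrightarrow> hecke t F w > 0" "len (t # w) > len w \<Longrightarrow> hecke t F (t # w) > 0"
    using assms(2)[of "t # w"] assms(3) by (auto simp: hecke_def)
qed

lemma heckes_pos:
  assumes "invariant F" "\<And>w. F w \<ge> 0" "F w > 0"
  shows "\<exists>v. heckes u F v > 0"
proof (induction u)
  case (Cons t u)
  then obtain v where v: "heckes u F v > 0" by blast
  have "len (t # v) < len v \<or> len (t # v) > len v" using len_Cons_cases[of t v] by auto
  then show ?case
    using hecke_pos[OF invariant_heckes[OF assms(1)] heckes_nonneg[OF assms(2)] v, of t] by auto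
qed (use assms in auto)

lemma heckes_support:
  assumes "\<And>w. F w \<noteq> 0 \<Longrightarrow> len w \<le> N"
  shows "heckes u F w \<noteq> 0 \<Longrightarrow> len w \<le> N + length u"
proof (induction u arbitrary: w)
  case (Cons t u)
  then have "heckes u F (t # w) \<noteq> 0 \<or> heckes u F w \<noteq> 0"
    by (auto simp: hecke_def split: if_splits)
  then show ?case using Cons.IH[of w] Cons.IH[of "t # w"] len_Cons_cases[of t w] by auto
qed (use assms in auto)

text \<open>Let \<open>G\<close> be the image, under \<open>u\<close>, of the indicator function of the identity. It is nonnegative and
  not zero, and the lengths in its support are bounded. If \<open>t\<close> divides \<open>u\<close> on the left, then \<open>G\<close> lies in
  the image of the nonnegative functions under the operator of \<open>t\<close>, and \<open>t\<close> shortens every element of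
  maximal length in the support. So an element of maximal length has all of \<open>T\<close> as left descents.\<close>

theorem common_multiple_imp_longest:
  assumes "\<And>t. t \<in> T \<Longrightarrow> \<exists>v. pres_cong S (artin_relations S m) (positive u) (positive (t # v))"
  shows "\<exists>y. longest T y"
proof -
  define F :: "'a list \<Rightarrow> real" where "F w = (if w \<approx> [] then 1 else 0)" for w
  have inv: "invariant F" unfolding invariant_def F_def using eqv_iff_left by metis
  have nonneg: "F w \<ge> 0" for w by (simp add: F_def)
  have "F [] > 0" by (simp add: F_def)
  from heckes_pos[OF inv nonneg this] obtain w0 where w0: "heckes u F w0 > 0" by blast
  have supp: "len w \<le> 0 + length u" if "heckes u F w > 0" for w
    using that heckes_support[of F 0 u w] len_eq_0 by (auto simp: F_def split: if_splits)
  obtain w where w: "heckes u F w > 0" and max: "\<And>v. heckes u F v > 0 \<Longrightarrow> len v \<le> len w"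
    using ex_has_greatest_nat[of "\<lambda>w. heckes u F w > 0" w0 len "Suc (length u)"] w0 supp
    by (auto simp: less_Suc_eq_le)
  have "descent (rev w) t" if t: "t \<in> T" for t
  proof (rule ccontr)
    assume "\<not> descent (rev w) t"
    then have up: "len (t # w) > len w" by (simp add: not_descent_iff len_snoc_rev)
    obtain v where v: "pres_cong S (artin_relations S m) (positive u) (positive (t # v))"
      using assms[OF t] by blast
    have eq: "heckes u F = hecke t (heckes v F)"
      using hecke_word_cong[OF v inv] unfolding hecke_word_positive by simp
    then have "heckes v F (t # w) > 0" using w up by (simp add: hecke_def)
    moreover have "len (t # t # w) = len w" using eqv_cancel_letter[of "[]" t w] len_cong by simp
    ultimately have "hecke t (heckes v F) (t # w) > 0"
      using hecke_pos(1)[OF invariant_heckes[OF inv] heckes_nonneg[OF nonneg], of v "t # w" t] up by simp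
    then show False using max[of "t # w"] up by (simp add: eq)
  qed
  then show ?thesis using all_descents_imp_longest by blast
qed

section \<open>Least common multiples and longest elements\<close>

definition artin_class :: "'a set \<Rightarrow> 'a list \<Rightarrow> 'a word set" where
  "artin_class S w = pres_rel S (artin_relations S m) `` {positive w}"

lemma artin_class_eq_iff:
  "set u \<subseteq> S \<Longrightarrow> set v \<subseteq> S
    \<Longrightarrow> artin_class S u = artin_class S v \<longleftrightarrow> pres_cong S (artin_relations S m) (positive u) (positive v)"
  unfolding artin_class_def by (intro pres_class_eq_iff) simp_all

lemma artin_class_mult:
  "set u \<subseteq> S \<Longrightarrow> set v \<subseteq> S
    \<Longrightarrow> artin_class S u \<otimes>\<^bsub>artin_monoid S m\<^esub> artin_class S v = artin_class S (u @ v)"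
  using pres_mult_class[of "positive u" S "positive v" "artin_relations S m"]
  by (simp add: artin_class_def artin_monoid_def artin_group_def)

lemma artin_class_one: "\<one>\<^bsub>artin_monoid S m\<^esub> = artin_class S []"
  by (simp add: artin_class_def artin_monoid_def artin_group_def pres_one)

lemma artin_gen_eq_class: "artin_gen S m s = artin_class S [s]"
  by (simp add: artin_class_def artin_gen_def)

lemma carrier_artin_monoid: "carrier (artin_monoid S m) = artin_class S ` {w. set w \<subseteq> S}"
proof
  let ?G = "artin_group S m"
  have mult: "artin_class S u \<otimes>\<^bsub>?G\<^esub> artin_class S v = artin_class S (u @ v)"
    if "set u \<subseteq> S" "set v \<subseteq> S" for u v
    using artin_class_mult[OF that] by (simp add: artin_monoid_def)
  have one: "\<one>\<^bsub>?G\<^esub> = artin_class S []"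
    using artin_class_one by (simp add: artin_monoid_def)
  have "submonoid (artin_class S ` {w. set w \<subseteq> S}) ?G"
  proof
    show "artin_class S ` {w. set w \<subseteq> S} \<subseteq> carrier ?G"
      unfolding artin_class_def artin_group_def
      by (intro image_subsetI pres_class_in_carrier) simp
    show "x \<otimes>\<^bsub>?G\<^esub> y \<in> artin_class S ` {w. set w \<subseteq> S}"
      if "x \<in> artin_class S ` {w. set w \<subseteq> S}" "y \<in> artin_class S ` {w. set w \<subseteq> S}" for x y
      using that by (auto simp: mult intro!: imageI)
    show "\<one>\<^bsub>?G\<^esub> \<in> artin_class S ` {w. set w \<subseteq> S}"
      by (auto simp: one)
  qed
  moreover have "artin_gen S m ` S \<subseteq> artin_class S ` {w. set w \<subseteq> S}"
    by (auto simp: artin_gen_eq_class)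
  ultimately show "carrier (artin_monoid S m) \<subseteq> artin_class S ` {w. set w \<subseteq> S}"
    unfolding artin_monoid_def by (simp add: hull_minimal)
  have "artin_class S w \<in> H" if "submonoid H ?G" "artin_gen S m ` S \<subseteq> H" "set w \<subseteq> S" for w H
    using that(3)
  proof (induction w)
    case Nil
    then show ?case using submonoid.one_closed[OF that(1)] one by simp
  next
    case (Cons s w)
    then have "artin_class S [s] \<otimes>\<^bsub>?G\<^esub> artin_class S w \<in> H"
      using that(2) by (intro submonoid.m_closed[OF that(1)]) (auto simp: artin_gen_eq_class)
    then show ?case using mult[of "[s]" w] Cons.prems by simp
  qed
  then show "artin_class S ` {w. set w \<subseteq> S} \<subseteq> carrier (artin_monoid S m)"
    unfolding artin_monoid_def hull_def by auto
qed

lemma artin_class_divides_iff: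
  assumes "set u \<subseteq> S" "set v \<subseteq> S"
  shows "artin_class S u divides\<^bsub>artin_monoid S m\<^esub> artin_class S v
    \<longleftrightarrow> (\<exists>c. set c \<subseteq> S \<and> pres_cong S (artin_relations S m) (positive v) (positive (u @ c)))"
  unfolding factor_def carrier_artin_monoid
  using assms by (auto simp: artin_class_mult artin_class_eq_iff simp del: positive_simps(3))

lemma left_lcm_SomeD: "left_lcm M X = Some d \<Longrightarrow> is_left_lcm M X d"
  unfolding left_lcm_def by (auto split: if_splits intro: theI')

lemma longest_divisible:
  assumes "longest T y" "T \<subseteq> S" "t \<in> T"
  shows "artin_class S [t] divides\<^bsub>artin_monoid S m\<^esub> artin_class S y"
proof -
  obtain c where c: "y \<approx> t # c" "reduced (t # c)" using longest_left[OF assms(1,3)] by blast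
  have y: "reduced y" "set y \<subseteq> S" using assms by (auto simp: longest_def)
  then have "set c \<subseteq> S" using reduced_set_eq[OF y(1) c(2,1)] by auto
  moreover have "pres_cong S (artin_relations S m) (positive y) (positive ([t] @ c))"
    using reduced_artin_cong[OF y(1) c(2,1) y(2)] by simp
  ultimately show ?thesis
    using artin_class_divides_iff[of "[t]" S y] y(2) assms(2,3) by auto
qed

text \<open>Lengths of positive words are additive, and the image of \<open>y\<close> in the Coxeter group has full length,
  so every divisor of \<open>y\<close> has full length as well.\<close>

lemma divides_reduced:
  assumes "artin_class S u divides\<^bsub>artin_monoid S m\<^esub> artin_class S y" "reduced y"
    "set u \<subseteq> S" "set y \<subseteq> S"
  obtains c where "y \<approx> u @ c" "reduced (u @ c)" "reduced u"
proof -
  obtain c where "pres_cong S (artin_relations S m) (positive y) (positive (u @ c))"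
    using assms artin_class_divides_iff by blast
  from artin_cong_imp_eqv[OF this] have c: "y \<approx> u @ c" "length y = length (u @ c)" .
  then have "reduced (u @ c)" using assms(2) len_cong[OF c(1)] by (simp add: reduced_def)
  then show thesis using that c(1) reduced_append(1) by blast
qed

text \<open>The lift of the longest element is a common multiple of \<open>T\<close>, hence a multiple of the least one. So
  the least one is represented by a reduced word over \<open>T\<close>. As a multiple of every \<open>t \<in> T\<close> it has all of
  \<open>T\<close> as descents.\<close>

theorem Delta_longest:
  assumes Delta: "Delta S m T = Some d" and T: "T \<subseteq> S" and y: "longest T y"
  obtains u where "d = artin_class S u" "longest T u"
proof -
  let ?M = "artin_monoid S m"
  have lcm: "is_left_lcm ?M (artin_gen S m ` T) d"
    using Delta unfolding Delta_def by (rule left_lcm_SomeD)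
  then obtain u where u: "d = artin_class S u" "set u \<subseteq> S"
    unfolding is_left_lcm_def carrier_artin_monoid by auto
  have yS: "set y \<subseteq> S" "reduced y" using y T by (auto simp: longest_def)
  have "artin_class S y \<in> carrier ?M" using yS unfolding carrier_artin_monoid by auto
  moreover have "\<forall>x\<in>artin_gen S m ` T. x divides\<^bsub>?M\<^esub> artin_class S y"
    using longest_divisible[OF y T] by (auto simp: artin_gen_eq_class)
  ultimately have "artin_class S u divides\<^bsub>?M\<^esub> artin_class S y"
    using lcm u(1) unfolding is_left_lcm_def by blast
  then obtain c where c: "y \<approx> u @ c" "reduced (u @ c)" "reduced u"
    using divides_reduced yS u(2) by blast
  have uT: "set u \<subseteq> T" using reduced_set_eq[OF yS(2) c(2,1)] y by (auto simp: longest_def)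
  have "descent (rev u) t" if t: "t \<in> T" for t
  proof -
    have "artin_class S [t] divides\<^bsub>?M\<^esub> artin_class S u"
      using lcm t u(1) unfolding is_left_lcm_def by (auto simp: artin_gen_eq_class)
    moreover have "set [t] \<subseteq> S" using t T by auto
    ultimately obtain e where e: "u \<approx> [t] @ e" "reduced ([t] @ e)"
      using divides_reduced[of S "[t]" u] c(3) u(2) by metis
    have "len (t # u) \<le> length e"
      using e(1) by (intro len_le_eqv) (metis append_Cons append_Nil eqv_move_letter eqv_sym)
    moreover have "len u = Suc (length e)"
      using e len_cong[OF e(1)] by (simp add: reduced_def)
    ultimately show ?thesis by (simp add: descent_def len_snoc_rev)
  qed
  then have "longest T (rev u)" using uT c(3) by (auto simp: longest_def reduced_rev)
  then have "u \<approx> rev u" using longest_rev eqv_sym by fastforce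
  then have "longest T u" using \<open>longest T (rev u)\<close> c(3) descent_cong
    by (auto simp: longest_def)
  then show thesis using that u(1) by blast
qed

text \<open>The word \<open>w\<close> is a common multiple of \<open>P \<union> Q\<close>, so the parabolic subgroup of \<open>P \<union> Q\<close> has a longest
  element. Its lift is a common multiple of the two given elements, so \<open>w\<close> divides it, and divisors
  of a reduced word are reduced.\<close>

theorem lcm_of_Deltas_reduced:
  assumes P: "longest P u" "P \<subseteq> S" and Q: "longest Q v" "Q \<subseteq> S"
    and DP: "Delta S m P = Some (artin_class S u)" and DQ: "Delta S m Q = Some (artin_class S v)"
    and lcm: "left_lcm (artin_monoid S m) {artin_class S u, artin_class S v} = Some (artin_class S w)"
    and w: "set w \<subseteq> S"
  shows "reduced w"
proof -
  let ?M = "artin_monoid S m"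
  have uv: "set u \<subseteq> S" "set v \<subseteq> S" using P Q by (auto simp: longest_def)
  note lcmP = left_lcm_SomeD[OF DP[unfolded Delta_def]]
  note lcmQ = left_lcm_SomeD[OF DQ[unfolded Delta_def]]
  note lcmw = left_lcm_SomeD[OF lcm]
  have "\<exists>c. pres_cong S (artin_relations S m) (positive w) (positive (t # c))" if t: "t \<in> P \<union> Q" for t
  proof -
    obtain x where x: "set x \<subseteq> S" "artin_class S [t] divides\<^bsub>?M\<^esub> artin_class S x"
      "artin_class S x divides\<^bsub>?M\<^esub> artin_class S w"
    proof (cases "t \<in> P")
      case True
      then show thesis
        using that[of u] uv(1) lcmw longest_divisible[OF P] by (auto simp: is_left_lcm_def)
    next
      case False
      then show thesis
        using that[of v] t uv(2) lcmw longest_divisible[OF Q] by (auto simp: is_left_lcm_def)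
    qed
    have tS: "set [t] \<subseteq> S" using t P(2) Q(2) by auto
    obtain c where c: "set c \<subseteq> S" "pres_cong S (artin_relations S m) (positive x) (positive ([t] @ c))"
      using x(2) artin_class_divides_iff[OF tS x(1)] by blast
    obtain e where e: "set e \<subseteq> S" "pres_cong S (artin_relations S m) (positive w) (positive (x @ e))"
      using x(3) artin_class_divides_iff[OF x(1) w] by blast
    have "pres_cong S (artin_relations S m) (positive x @ positive e) (positive ([t] @ c) @ positive e)"
      using c(2) e(1) by (intro pres_cong.append pres_cong.refl) auto
    then have "pres_cong S (artin_relations S m) (positive w) (positive (t # c @ e))"
      using e(2) pres_cong.trans by (metis append_Cons append_Nil append_assoc positive_simps(3))
    then show ?thesis by blast
  qed
  then obtain y where y: "longest (P \<union> Q) y" using common_multiple_imp_longest by meson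
  have yS: "reduced y" "set y \<subseteq> S" using y P(2) Q(2) by (auto simp: longest_def)
  have yM: "artin_class S y \<in> carrier ?M" using yS unfolding carrier_artin_monoid by auto
  have div: "artin_class S [t] divides\<^bsub>?M\<^esub> artin_class S y" if "t \<in> P \<union> Q" for t
    using longest_divisible[OF y] that P(2) Q(2) by blast
  have "artin_class S u divides\<^bsub>?M\<^esub> artin_class S y"
    using lcmP yM div unfolding is_left_lcm_def by (auto simp: artin_gen_eq_class)
  moreover have "artin_class S v divides\<^bsub>?M\<^esub> artin_class S y"
    using lcmQ yM div unfolding is_left_lcm_def by (auto simp: artin_gen_eq_class)
  ultimately have "artin_class S w divides\<^bsub>?M\<^esub> artin_class S y"
    using lcmw yM unfolding is_left_lcm_def by auto
  then show ?thesis using divides_reduced yS w by blast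
qed

lemma alternating_prod_class:
  assumes "set u \<subseteq> S" "set v \<subseteq> S"
  shows "alternating_prod (artin_monoid S m) (artin_class S u) (artin_class S v) n
    = artin_class S (concat (alternating u v n))"
  using assms
proof (induction n arbitrary: u v)
  case (Suc n)
  have "set (concat (alternating v u n)) \<subseteq> S"
    using Suc.prems set_alternating[of v u n] by auto
  then show ?case using Suc by (simp add: alternating_prod_def artin_class_mult)
qed (simp add: alternating_prod_def artin_class_one)

end

section \<open>Substituting longest elements for generators\<close>

text \<open>What remains of an LCM-homomorphism at the level of the Coxeter groups: \<open>\<delta> s\<close> is a reduced word of
  the longest element of \<open>p s\<close>. The least common multiples for the finite bonds survive as
  \<open>finite_bond\<close>, and the condition on the infinite bonds as \<open>infinite_bond\<close>.\<close>

locale lcm_substitution = A: coxeter m + B: coxeter m'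
  for m :: "'a \<Rightarrow> 'a \<Rightarrow> enat" and m' :: "'b \<Rightarrow> 'b \<Rightarrow> enat" +
  fixes S :: "'a set" and p :: "'a \<Rightarrow> 'b set" and \<delta> :: "'a \<Rightarrow> 'b list"
  assumes longest: "s \<in> S \<Longrightarrow> B.longest (p s) (\<delta> s)"
    and nonempty: "s \<in> S \<Longrightarrow> p s \<noteq> {}"
    and braid: "s \<in> S \<Longrightarrow> t \<in> S \<Longrightarrow> s \<noteq> t \<Longrightarrow> m s t = enat k
      \<Longrightarrow> B.eqv (concat (map \<delta> (alternating s t k))) (concat (map \<delta> (alternating t s k)))"
    and finite_bond: "s \<in> S \<Longrightarrow> t \<in> S \<Longrightarrow> s \<noteq> t \<Longrightarrow> m s t = enat k
      \<Longrightarrow> B.reduced (concat (map \<delta> (alternating s t k)))"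
    and infinite_bond: "s \<in> S \<Longrightarrow> t \<in> S \<Longrightarrow> s \<noteq> t \<Longrightarrow> m s t = \<infinity> \<Longrightarrow> u \<in> p s
      \<Longrightarrow> \<not> B.longest (insert u (p t)) y"
begin

definition substitute :: "'a list \<Rightarrow> 'b list" where
  "substitute w = concat (map \<delta> w)"

lemma substitute_simps [simp]: "substitute [] = []" "substitute (s # w) = \<delta> s @ substitute w"
  "substitute (u @ v) = substitute u @ substitute v"
  by (simp_all add: substitute_def)

lemma pres_cong_substitute:
  "pres_cong S (coxeter_relations S m) x y \<Longrightarrow> B.eqv (substitute (map fst x)) (substitute (map fst y))"
proof (induction rule: pres_cong.induct)
  case (cancel s b)
  then show ?case using B.longest_square[OF longest] by simp
next
  case (rel x y)
  from rel.hyps(1) show ?case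
    unfolding coxeter_relations_def artin_relations_def
    using braid B.longest_square[OF longest] by (auto simp: map_alternating substitute_def)
next
  case (sym x y)
  show ?case by (rule B.eqv_sym[OF sym.IH])
next
  case (trans x y z)
  show ?case by (rule B.eqv_trans[OF trans.IH])
next
  case (append x y x' y')
  then show ?case by (simp add: B.eqv_append)
qed simp

lemma substitute_cong:
  "set u \<subseteq> S \<Longrightarrow> set v \<subseteq> S \<Longrightarrow> A.eqv u v \<Longrightarrow> B.eqv (substitute u) (substitute v)"
  using pres_cong_substitute[OF A.parabolic_injective] by simp

lemma descents_substitute_snoc:
  assumes s: "s \<in> S" and nd: "\<And>u. u \<in> p s \<Longrightarrow> \<not> B.descent (substitute w) u" and u: "u \<in> p s"
  shows "B.descent (substitute (w @ [s])) u"
proof -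
  have sub: "set (\<delta> s) \<subseteq> p s" using longest[OF s] by (simp add: B.longest_def)
  have "B.len (substitute w @ \<delta> s) = B.len (substitute w) + B.len (\<delta> s)"
    "B.len (substitute w @ \<delta> s @ [u]) = B.len (substitute w) + B.len (\<delta> s @ [u])"
    using sub u nd by (auto intro!: B.no_descent_additive[of "p s"])
  moreover have "B.len (\<delta> s @ [u]) < B.len (\<delta> s)"
    using longest[OF s] u by (simp add: B.longest_def B.descent_def)
  ultimately show ?thesis by (simp add: B.descent_def)
qed

text \<open>The image of a word that ends in \<open>s\<close> has all of \<open>p s\<close> as descents. One more descent \<open>u \<in> p t\<close> would
  give a longest element of \<open>insert u (p s)\<close>.\<close>

lemma infinite_bond_no_descent:
  assumes "s \<in> S" "t \<in> S" "s \<noteq> t" "m s t = \<infinity>" "u \<in> p t"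
  shows "\<not> B.descent (substitute (rev (alternating s t n))) u"
  using assms
proof (induction n arbitrary: s t u)
  case (Suc n)
  have ts: "m t s = \<infinity>" using Suc.prems(4) A.m_sym by metis
  let ?w = "rev (alternating t s n)"
  have eq: "rev (alternating s t (Suc n)) = ?w @ [s]" by simp
  have desc: "B.descent (substitute (?w @ [s])) v" if "v \<in> p s" for v
    using descents_substitute_snoc Suc.IH[OF Suc.prems(2,1) _ ts] Suc.prems(1,3) that by metis
  show ?case
  proof
    assume "B.descent (substitute (rev (alternating s t (Suc n)))) u"
    then have "\<forall>v\<in>insert u (p s). B.descent (substitute (?w @ [s])) v"
      unfolding eq using desc by blast
    then obtain y where "B.longest (insert u (p s)) y" using B.all_descents_imp_longest by blast
    then show False using infinite_bond[OF Suc.prems(2,1) _ ts Suc.prems(5)] Suc.prems(3) by metis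
  qed
qed (simp add: B.descent_def)

text \<open>Appending \<open>s\<close> to the word gives a factor of an alternating word of length \<open>k\<close>, whose image is
  reduced by assumption. So the image stays reduced when \<open>\<delta> s\<close> is appended, and \<open>\<delta> s\<close> has a reduced
  word that begins with \<open>u\<close>.\<close>

lemma finite_bond_no_descent:
  assumes st: "s \<in> S" "t \<in> S" "s \<noteq> t" and k: "m s t = enat k" "n < k" and u: "u \<in> p s"
  shows "\<not> B.descent (substitute (rev (alternating t s n))) u"
proof
  let ?w = "rev (alternating t s n)"
  assume desc: "B.descent (substitute ?w) u"
  obtain a b where ab: "?w @ [s] = alternating a b (Suc n)" "{a, b} = {s, t}"
  proof -
    have "?w @ [s] = rev (alternating s t (Suc n))" by simp
    also have "\<dots> = (if even (Suc n) then alternating t s (Suc n) else alternating s t (Suc n))"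
      by (rule rev_alternating)
    finally show thesis using that[of s t] that[of t s] by (auto split: if_splits)
  qed
  obtain r where r: "alternating a b k = alternating a b (Suc n) @ r"
    using alternating_add[of a b "Suc n" "k - Suc n"] k(2) by (metis Suc_leI le_add_diff_inverse)
  have "a \<in> S" "b \<in> S" "a \<noteq> b" "m a b = enat k"
    using ab(2) st k(1) A.m_sym[of s t] by (auto simp: doubleton_eq_iff)
  then have "B.reduced (substitute (alternating a b k))" unfolding substitute_def by (rule finite_bond)
  then have red: "B.reduced (substitute ?w @ \<delta> s)"
    unfolding r ab(1)[symmetric] using B.reduced_append(1) by auto
  obtain c where c: "B.eqv (\<delta> s) (u # c)" "B.reduced (u # c)"
    using B.longest_left[OF longest u] st(1) by blast
  have "length (\<delta> s) = Suc (length c)"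
    using B.reduced_eqv_length[OF _ c(2,1)] B.reduced_append(2)[OF red] by simp
  moreover have "B.len (substitute ?w @ \<delta> s) = B.len ((substitute ?w @ [u]) @ c)"
    using B.len_cong[OF B.eqv_append_right[OF c(1)]] by simp
  moreover have "B.len ((substitute ?w @ [u]) @ c) \<le> B.len (substitute ?w @ [u]) + length c"
    using B.len_append[of "substitute ?w @ [u]" c] B.len_le_length[of c] by linarith
  moreover have "B.len (substitute ?w @ [u]) < length (substitute ?w)"
    using desc B.len_le_length[of "substitute ?w"] unfolding B.descent_def by linarith
  moreover have "B.len (substitute ?w @ \<delta> s) = length (substitute ?w) + length (\<delta> s)"
    using red by (simp add: B.reduced_def)
  ultimately show False by linarith
qed

text \<open>Induction on the length of \<open>w\<close>. Let \<open>t\<close> be a descent of \<open>w\<close>, and split \<open>w\<close> into a minimal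
  representative \<open>z\<close> of its coset modulo the subgroup of \<open>s\<close> and \<open>t\<close> and an alternating word \<open>y\<close>. By
  induction, the image of \<open>z\<close> has no descent in \<open>p s \<union> p t\<close>, so it adds its length to that of any
  word over \<open>p s \<union> p t\<close>. This leaves the question for \<open>y\<close>, which is the dihedral case.\<close>

theorem no_descent_substitute:
  "set w \<subseteq> S \<Longrightarrow> s \<in> S \<Longrightarrow> \<not> A.descent w s \<Longrightarrow> u \<in> p s \<Longrightarrow> \<not> B.descent (substitute w) u"
proof (induction "A.len w" arbitrary: w s u rule: less_induct)
  case less
  show ?case
  proof (cases "A.len w = 0")
    case True
    then have "B.eqv (substitute w) (substitute [])"
      using less.prems(1) by (intro substitute_cong) (auto simp: A.len_eq_0)
    then have "B.descent (substitute w) u = B.descent [] u" using B.descent_cong by fastforce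
    then show ?thesis by (simp add: B.descent_def)
  next
    case False
    obtain v where v: "A.reduced v" "A.eqv v w" "set v \<subseteq> set w" by (rule A.exists_reduced_subset)
    have "v \<noteq> []" using False A.len_cong[OF v(2)] by auto
    then obtain v' t where v': "v = v' @ [t]" by (metis rev_exhaust)
    have t: "t \<in> S" using v(3) v' less.prems(1) by auto
    have desc: "A.descent w t" 
      using A.reduced_snoc_descent v(1) v' A.descent_cong[OF v(2)] by blast
    then have "s \<noteq> t" using less.prems(3) by auto
    obtain z0 y where z0: "A.minimal_in_coset {s, t} z0" and y: "A.reduced y" "set y \<subseteq> {s, t}"
      and wzy0: "A.eqv w (z0 @ y)" "A.len w = A.len z0 + length y"
      by (rule A.coset_decomposition)
    obtain z where z: "A.reduced z" "A.eqv z z0" by (metis A.exists_reduced)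
    have wzy: "A.eqv w (z @ y)"
      using wzy0(1) A.eqv_append_left[OF z(2)] A.eqv_sym A.eqv_trans by blast
    have lenz: "A.len z = A.len z0" using A.len_cong[OF z(2)] .
    have nd: "\<not> A.descent z s" "\<not> A.descent z t"
      using z0 A.descent_cong[OF z(2)] unfolding A.minimal_iff_no_descent by auto
    have "A.reduced (z @ y)"
      using A.len_cong[OF wzy] wzy0(2) lenz z(1) by (simp add: A.reduced_def)
    then have "set (z @ y) \<subseteq> set w"
      by (rule A.reduced_set_subset) (rule A.eqv_sym[OF wzy])
    then have zS: "set z \<subseteq> S" and yS: "set y \<subseteq> S" using less.prems(1) by auto
    have "y \<noteq> []"
    proof
      assume "y = []"
      then show False using A.descent_cong[OF wzy] desc nd(2) by simp
    qed
    then have lz: "A.len z < A.len w" using wzy0(2) lenz by simp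
    have ndz: "\<not> B.descent (substitute z) x" if "x \<in> p s \<union> p t" for x
      using that less.hyps[OF lz zS less.prems(2) nd(1)] less.hyps[OF lz zS t nd(2)] by blast
    have additive: "B.len (substitute z @ x) = B.len (substitute z) + B.len x" if "set x \<subseteq> p s \<union> p t" for x
      using ndz that by (rule B.no_descent_additive)
    have sub: "set (substitute y) \<subseteq> p s \<union> p t"
      using y(2) longest[OF t] longest[OF less.prems(2)] unfolding substitute_def B.longest_def by fastforce
    have ndy: "\<not> B.descent (substitute y) u"
    proof -
      have "A.len (z @ y @ [s]) = A.len z + A.len (y @ [s])"
        using nd y(2) by (intro A.no_descent_additive[of "{s, t}"]) auto
      moreover have "A.len (z @ y @ [s]) = Suc (A.len w)"
        using A.len_cong[OF A.eqv_append_left[OF wzy], of "[s]"] less.prems(3)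
        by (simp add: A.not_descent_iff)
      ultimately have ys: "A.reduced (y @ [s])"
        using wzy0(2) lenz by (simp add: A.reduced_def)
      then have "rev (y @ [s]) = alternating s t (length (rev (y @ [s])))"
        using y(2) A.reduced_rev[of "y @ [s]"] by (intro A.reduced_alternating) auto
      then have "s # rev y = s # alternating t s (length y)" by simp
      then have ry: "y = rev (alternating t s (length y))" by (metis list.inject rev_rev_ident)
      show ?thesis
      proof (cases "m s t")
        case (enat k)
        have "A.reduced (alternating s t (Suc (length y)) @ [])"
        proof -
          have "rev (y @ [s]) = alternating s t (Suc (length y))"
            using \<open>s # rev y = _\<close> by simp
          then show ?thesis using ys A.reduced_rev[of "y @ [s]"] by simp
        qed
        then have "length y < k" using A.alternating_not_reduced[OF enat] by (meson Suc_le_eq not_less)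
        then show ?thesis
          using finite_bond_no_descent[OF less.prems(2) t \<open>s \<noteq> t\<close> enat _ less.prems(4)] ry by metis
      next
        case infinity
        then have "m t s = \<infinity>" using A.m_sym by metis
        then show ?thesis
          using infinite_bond_no_descent[OF t less.prems(2) _ _ less.prems(4)] \<open>s \<noteq> t\<close> ry by metis
      qed
    qed
    have "B.len (substitute z @ substitute y @ [u]) = B.len (substitute z) + B.len (substitute y @ [u])"
      using sub less.prems(4) by (intro additive) auto
    also have "\<dots> = Suc (B.len (substitute z) + B.len (substitute y))"
      using ndy by (simp add: B.not_descent_iff)
    also have "\<dots> = Suc (B.len (substitute z @ substitute y))" using additive[OF sub] by simp
    finally have "\<not> B.descent (substitute (z @ y)) u" by (simp add: B.not_descent_iff)
    moreover have "B.eqv (substitute w) (substitute (z @ y))"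
      using less.prems(1) zS yS wzy by (intro substitute_cong) auto
    ultimately show ?thesis using B.descent_cong by blast
  qed
qed

text \<open>The last letter \<open>s\<close> of a reduced word forces the image to have the elements of \<open>p s\<close> as descents,
  but the identity has no descents.\<close>

corollary substitute_kernel:
  assumes w: "set w \<subseteq> S" and triv: "B.eqv (substitute w) []"
  shows "A.eqv w []"
proof (rule ccontr)
  assume "\<not> A.eqv w []"
  obtain v where v: "A.reduced v" "A.eqv v w" "set v \<subseteq> set w" by (rule A.exists_reduced_subset)
  have "v \<noteq> []" using v(2) \<open>\<not> A.eqv w []\<close> A.eqv_sym by blast
  then obtain v' s where v': "v = v' @ [s]" by (metis rev_exhaust)
  have s: "s \<in> S" and v'S: "set v' \<subseteq> S" using v(3) v' w by auto
  have "\<not> A.descent v' s" using A.reduced_snoc_iff v(1) v' A.reduced_append(1) by blast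
  then have "\<not> B.descent (substitute v') u" if "u \<in> p s" for u
    using no_descent_substitute[OF v'S s _ that] by blast
  moreover obtain u where u: "u \<in> p s" using nonempty[OF s] by blast
  ultimately have "B.descent (substitute v) u" unfolding v' using descents_substitute_snoc[OF s] by blast
  moreover have "B.eqv (substitute v) (substitute w)" using v w by (intro substitute_cong) auto
  then have "B.descent (substitute v) u = B.descent [] u"
    using B.descent_cong B.eqv_trans triv by blast
  ultimately show False by (simp add: B.descent_def)
qed

corollary substitute_injective:
  assumes "set u \<subseteq> S" "set v \<subseteq> S" "B.eqv (substitute u) (substitute v)"
  shows "A.eqv u v"
proof -
  have "B.eqv (substitute (u @ rev v)) (substitute (v @ rev v))"
    using B.eqv_append_left[OF assms(3)] by simp
  also have "B.eqv (substitute (v @ rev v)) (substitute [])"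
    using assms(2) A.eqv_rev_right by (intro substitute_cong) auto
  finally have "A.eqv (u @ rev v) []" using assms by (intro substitute_kernel) auto
  then show ?thesis using A.eqv_move_right[of u "rev v" "[]"] by simp
qed

end

section \<open>The induced homomorphism\<close>

context lcm_substitution
begin

abbreviation coxeter_class :: "'b set \<Rightarrow> 'b list \<Rightarrow> 'b word set" where
  "coxeter_class S' w \<equiv> pres_rel S' (coxeter_relations S' m') `` {positive w}"

lemma set_substitute:
  assumes "\<And>s. s \<in> S \<Longrightarrow> p s \<subseteq> S'" "set w \<subseteq> S"
  shows "set (substitute w) \<subseteq> S'"
  using assms longest unfolding substitute_def B.longest_def by fastforce

text \<open>The substitution respects the relations of the Coxeter group on \<open>S\<close>, so it defines \<open>\<psi>\<close>. Both
  sides of the compatibility are homomorphisms on the Artin-Tits group, so generators suffice; for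
  an inverse generator, the image of \<open>\<delta> s\<close> is an involution.\<close>

theorem induced_hom:
  assumes pS: "\<And>s. s \<in> S \<Longrightarrow> p s \<subseteq> S'"
    and \<phi>: "\<phi> \<in> hom (artin_group S m) (artin_group S' m')"
    and \<phi>_gen: "\<And>s. s \<in> S \<Longrightarrow> \<phi> (artin_gen S m s) = B.artin_class S' (\<delta> s)"
  shows "\<exists>\<psi>. \<psi> \<in> hom (coxeter_group S m) (coxeter_group S' m')
    \<and> (\<forall>x\<in>carrier (artin_group S m). \<psi> (canonical_surj S m x) = canonical_surj S' m' (\<phi> x))
    \<and> inj_on \<psi> (carrier (coxeter_group S m))"
proof -
  let ?R = "coxeter_relations S m" and ?R' = "coxeter_relations S' m'"
  let ?cl = "\<lambda>x. pres_rel S ?R `` {x}"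
  let ?W = "coxeter_group S m" and ?W' = "coxeter_group S' m'"
  define \<psi> where "\<psi> X = coxeter_class S' (substitute (map fst (SOME x. x \<in> X)))" for X :: "'a word set"
  have fst_S: "set (map fst x) \<subseteq> S" if "x \<in> words S" for x :: "'a word" using that by auto
  have sub: "positive (substitute (map fst x)) \<in> words S'" if "x \<in> words S" for x :: "'a word"
    using set_substitute[OF pS fst_S[OF that]] by simp
  have \<psi>: "\<psi> (?cl x) = coxeter_class S' (substitute (map fst x))" if x: "x \<in> words S" for x
  proof -
    have "x \<in> ?cl x" using x by (simp add: pres_rel_def pres_cong.refl)
    then have "(SOME z. z \<in> ?cl x) \<in> ?cl x" by (rule someI)
    then obtain z where z: "(SOME z. z \<in> ?cl x) = z" "pres_cong S ?R x z" by (simp add: pres_rel_def)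
    have zS: "z \<in> words S" using pres_cong_words[OF z(2)] by simp
    have "pres_cong S' ?R' (positive (substitute (map fst z))) (positive (substitute (map fst x)))"
      using sub[OF x] sub[OF zS] B.eqv_sym[OF pres_cong_substitute[OF z(2)]]
      by (intro B.parabolic_injective) simp_all
    then show ?thesis unfolding \<psi>_def z(1) using sub[OF x] sub[OF zS] by (simp only: pres_class_eq_iff)
  qed
  have mult: "?cl x \<otimes>\<^bsub>?W\<^esub> ?cl y = ?cl (x @ y)" if "x \<in> words S" "y \<in> words S" for x y
    unfolding coxeter_group_def by (rule pres_mult_class[OF that])
  have mult': "coxeter_class S' u \<otimes>\<^bsub>?W'\<^esub> coxeter_class S' v = coxeter_class S' (u @ v)"
    if "set u \<subseteq> S'" "set v \<subseteq> S'" for u v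
    unfolding coxeter_group_def using that by (simp add: pres_mult_class)
  have hom: "\<psi> \<in> hom ?W ?W'"
  proof (rule homI)
    fix X assume "X \<in> carrier ?W"
    then obtain x where x: "x \<in> words S" "X = ?cl x" unfolding coxeter_group_def by (rule pres_carrierE)
    show "\<psi> X \<in> carrier ?W'"
      unfolding x(2) \<psi>[OF x(1)] unfolding coxeter_group_def by (rule pres_class_in_carrier[OF sub[OF x(1)]])
    fix Y assume "Y \<in> carrier ?W"
    then obtain y where y: "y \<in> words S" "Y = ?cl y" unfolding coxeter_group_def by (rule pres_carrierE)
    have xy: "x @ y \<in> words S" using x(1) y(1) by simp
    show "\<psi> (X \<otimes>\<^bsub>?W\<^esub> Y) = \<psi> X \<otimes>\<^bsub>?W'\<^esub> \<psi> Y"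
      unfolding x(2) y(2) mult[OF x(1) y(1)] \<psi>[OF x(1)] \<psi>[OF y(1)] \<psi>[OF xy]
      using mult' set_substitute[OF pS fst_S[OF x(1)]] set_substitute[OF pS fst_S[OF y(1)]] by simp
  qed
  have inj: "inj_on \<psi> (carrier ?W)"
  proof (rule inj_onI)
    fix X Y assume "X \<in> carrier ?W" "Y \<in> carrier ?W" and eq: "\<psi> X = \<psi> Y"
    then obtain x y where x: "x \<in> words S" "X = ?cl x" and y: "y \<in> words S" "Y = ?cl y"
      unfolding coxeter_group_def by (metis pres_carrierE)
    have "pres_cong S' ?R' (positive (substitute (map fst x))) (positive (substitute (map fst y)))"
      using eq unfolding x(2) y(2) \<psi>[OF x(1)] \<psi>[OF y(1)] pres_class_eq_iff[OF sub[OF x(1)] sub[OF y(1)]] .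
    from B.pres_cong_imp_eqv[OF this] have "B.eqv (substitute (map fst x)) (substitute (map fst y))" by simp
    then have "A.eqv (map fst x) (map fst y)" by (rule substitute_injective[OF fst_S[OF x(1)] fst_S[OF y(1)]])
    then have "pres_cong S ?R (positive (map fst x)) (positive (map fst y))"
      by (rule A.parabolic_injective[OF fst_S[OF x(1)] fst_S[OF y(1)]])
    then have "pres_cong S ?R x y"
      using pres_cong_coxeter_positive[OF x(1)] pres_cong_coxeter_positive[OF y(1)]
        pres_cong.sym pres_cong.trans by metis
    then show "X = Y" unfolding x(2) y(2) pres_class_eq_iff[OF x(1) y(1)] .
  qed
  \<comment> \<open>The other way around the square.\<close>
  define h where "h = canonical_surj S' m' \<circ> \<phi>"
  let ?A = "artin_group S m"
  let ?a = "\<lambda>x. pres_rel S (artin_relations S m) `` {x}"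
  have h_hom: "h \<in> hom ?A ?W'" unfolding h_def using \<phi> canonical_surj_hom by (rule hom_compose)
  have a_mult: "?a x \<otimes>\<^bsub>?A\<^esub> ?a y = ?a (x @ y)" if "x \<in> words S" "y \<in> words S" for x y
    unfolding artin_group_def by (rule pres_mult_class[OF that])
  have a_carrier: "?a x \<in> carrier ?A" if "x \<in> words S" for x
    unfolding artin_group_def by (rule pres_class_in_carrier[OF that])
  have h_one: "h (?a []) = coxeter_class S' []"
  proof -
    have "h \<one>\<^bsub>?A\<^esub> = \<one>\<^bsub>?W'\<^esub>"
      using hom_one[OF h_hom group_artin_group group_coxeter_group] .
    then show ?thesis unfolding artin_group_def coxeter_group_def pres_one by simp
  qed
  have \<delta>S: "set (\<delta> s) \<subseteq> S'" if "s \<in> S" for s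
    using longest[OF that] pS[OF that] by (auto simp: B.longest_def)
  have h_gen: "h (?a [(s, True)]) = coxeter_class S' (\<delta> s)" if "s \<in> S" for s
  proof -
    have "h (?a [(s, True)]) = canonical_surj S' m' (B.artin_class S' (\<delta> s))"
      using \<phi>_gen[OF that] by (simp add: h_def artin_gen_def)
    also have "\<dots> = coxeter_class S' (\<delta> s)"
      unfolding B.artin_class_def using \<delta>S[OF that] by (intro canonical_surj_class) simp
    finally show ?thesis .
  qed
  have square: "coxeter_class S' (\<delta> s) \<otimes>\<^bsub>?W'\<^esub> coxeter_class S' (\<delta> s) = coxeter_class S' []"
    if s: "s \<in> S" for s
  proof -
    have "pres_cong S' ?R' (positive (\<delta> s @ \<delta> s)) (positive [])"
      using \<delta>S[OF s] B.longest_square[OF longest[OF s]] by (intro B.parabolic_injective) auto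
    then show ?thesis
      using \<delta>S[OF s] pres_class_eq_iff[of "positive (\<delta> s @ \<delta> s)" S' "positive []" ?R']
      by (simp add: mult')
  qed
  have h_letter: "h (?a [(s, b)]) = coxeter_class S' (\<delta> s)" if s: "s \<in> S" for s b
  proof (cases b)
    case False
    interpret W': group ?W' by (rule group_coxeter_group)
    have "pres_cong S (artin_relations S m) [(s, False), (s, \<not> False)] []"
      using s by (rule pres_cong.cancel)
    then have "?a [(s, False)] \<otimes>\<^bsub>?A\<^esub> ?a [(s, True)] = ?a []"
      using s by (subst a_mult) (auto simp: pres_class_eq_iff)
    then have "h (?a [(s, False)]) \<otimes>\<^bsub>?W'\<^esub> h (?a [(s, True)]) = h (?a [])"
      using hom_mult[OF h_hom a_carrier a_carrier, of "[(s, False)]" "[(s, True)]"] s by simp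
    then have "h (?a [(s, False)]) \<otimes>\<^bsub>?W'\<^esub> coxeter_class S' (\<delta> s)
        = coxeter_class S' (\<delta> s) \<otimes>\<^bsub>?W'\<^esub> coxeter_class S' (\<delta> s)"
      using h_gen[OF s] h_one square[OF s] by simp
    moreover have "coxeter_class S' (\<delta> s) \<in> carrier ?W'"
      unfolding coxeter_group_def using \<delta>S[OF s] by (intro pres_class_in_carrier) simp
    moreover have "h (?a [(s, False)]) \<in> carrier ?W'"
      using s by (intro hom_in_carrier[OF h_hom] a_carrier) auto
    ultimately show ?thesis using False W'.right_cancel by simp
  qed (use h_gen s in simp)
  have h_word: "h (?a x) = coxeter_class S' (substitute (map fst x))" if "x \<in> words S" for x
    using that
  proof (induction x)
    case (Cons c x)
    obtain s b where c: "c = (s, b)" by force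
    have s: "s \<in> S" and x: "x \<in> words S" using Cons.hyps c by auto
    have "h (?a (c # x)) = h (?a [(s, b)] \<otimes>\<^bsub>?A\<^esub> ?a x)"
      using a_mult[of "[(s, b)]" x] s x c by simp
    also have "\<dots> = h (?a [(s, b)]) \<otimes>\<^bsub>?W'\<^esub> h (?a x)"
      using s x by (intro hom_mult[OF h_hom] a_carrier) auto
    also have "\<dots> = coxeter_class S' (\<delta> s @ substitute (map fst x))"
      using Cons.IH h_letter[OF s] mult' \<delta>S[OF s] set_substitute[OF pS fst_S[OF x]] by simp
    finally show ?case by (simp add: c)
  qed (simp add: h_one)
  have "\<psi> (canonical_surj S m X) = canonical_surj S' m' (\<phi> X)" if "X \<in> carrier ?A" for X
  proof -
    obtain x where x: "x \<in> words S" "X = ?a x"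
      using \<open>X \<in> carrier ?A\<close> unfolding artin_group_def by (rule pres_carrierE)
    show ?thesis using h_word[OF x(1)] \<psi>[OF x(1)] canonical_surj_class[OF x(1), of m]
      unfolding x(2) h_def by simp
  qed
  then show ?thesis using hom inj by blast
qed

end

section \<open>Extending a Coxeter matrix to all letters\<close>

text \<open>Letters outside \<open>S\<close> get infinite bonds, that is, no new relation besides involutivity. Everything
  that is defined from letters in \<open>S\<close> stays the same.\<close>

definition coxeter_extension :: "'a set \<Rightarrow> ('a \<Rightarrow> 'a \<Rightarrow> enat) \<Rightarrow> 'a \<Rightarrow> 'a \<Rightarrow> enat" where
  "coxeter_extension S m s t = (if s \<in> S \<and> t \<in> S then m s t else if s = t then 1 else \<infinity>)"

lemma coxeter_coxeter_extension:
  assumes "coxeter_matrix S m"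
  shows "coxeter (coxeter_extension S m)"
  using assms unfolding coxeter_matrix_def
  by unfold_locales (auto simp: coxeter_matrix_def coxeter_extension_def)

lemma artin_relations_extension:
  "T \<subseteq> S \<Longrightarrow> artin_relations T (coxeter_extension S m) = artin_relations T m"
  unfolding artin_relations_def coxeter_extension_def by (auto; blast)

lemma extension_simps:
  assumes "T \<subseteq> S"
  shows "artin_group T (coxeter_extension S m) = artin_group T m"
    "coxeter_group T (coxeter_extension S m) = coxeter_group T m"
    "spherical (coxeter_extension S m) T = spherical m T"
    "canonical_surj T (coxeter_extension S m) = canonical_surj T m"
    "artin_gen T (coxeter_extension S m) = artin_gen T m"
    "artin_monoid T (coxeter_extension S m) = artin_monoid T m"
    "Delta T (coxeter_extension S m) = Delta T m"
  by (simp_all add: fun_eq_iff artin_group_def coxeter_group_def spherical_def canonical_surj_def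
      artin_gen_def artin_monoid_def Delta_def coxeter_relations_def artin_relations_extension[OF assms])

lemma lcm_homomorphism_extension:
  assumes "lcm_homomorphism S m S' m' p \<phi>"
  shows "lcm_homomorphism S (coxeter_extension S m) S' (coxeter_extension S' m') p \<phi>"
proof -
  have sph: "spherical (coxeter_extension S' m') T = spherical m' T" if "T \<subseteq> S'" for T
    using that by (rule extension_simps)
  have mat: "coxeter_extension S m s t = m s t" if "s \<in> S" "t \<in> S" for s t
    using that by (simp add: coxeter_extension_def)
  have p: "p s \<subseteq> S'" if "s \<in> S" for s
    using assms that by (simp add: lcm_homomorphism_def lcm_condition_def)
  have sph1: "spherical (coxeter_extension S' m') (p s) = spherical m' (p s)" if "s \<in> S" for s
    using sph p that by blast
  have sph2: "spherical (coxeter_extension S' m') ({u} \<union> p t) = spherical m' ({u} \<union> p t)"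
    if "s \<in> S" "t \<in> S" "u \<in> p s" for s t u
    using p that by (intro sph) blast
  have "lcm_condition S (coxeter_extension S m) S' (coxeter_extension S' m') p
      = lcm_condition S m S' m' p"
    unfolding lcm_condition_def extension_simps[OF subset_refl]
    by (intro conj_cong ball_cong all_cong1 imp_cong refl) (simp_all only: mat sph1 sph2)
  then show ?thesis using assms
    unfolding lcm_homomorphism_def extension_simps[OF subset_refl] by simp
qed

theorem proposition0p2:
  fixes S :: "'a set" and m :: "'a \<Rightarrow> 'a \<Rightarrow> enat"
    and S' :: "'b set" and m' :: "'b \<Rightarrow> 'b \<Rightarrow> enat"
    and p :: "'a \<Rightarrow> 'b set" and \<phi> :: "'a word set \<Rightarrow> 'b word set"
  assumes "finite S" and "coxeter_matrix S m"
    and "finite S'" and "coxeter_matrix S' m'"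
    and "lcm_homomorphism S m S' m' p \<phi>"
  shows "\<exists>\<psi>. \<psi> \<in> hom (coxeter_group S m) (coxeter_group S' m')
    \<and> (\<forall>x\<in>carrier (artin_group S m). \<psi> (canonical_surj S m x) = canonical_surj S' m' (\<phi> x))
    \<and> inj_on \<psi> (carrier (coxeter_group S m))"
proof -
  let ?m = "coxeter_extension S m" and ?m' = "coxeter_extension S' m'"
  interpret A: coxeter ?m using assms(2) by (rule coxeter_coxeter_extension)
  interpret B: coxeter ?m' using assms(4) by (rule coxeter_coxeter_extension)
  have lcm: "lcm_condition S ?m S' ?m' p" and \<phi>: "\<phi> \<in> hom (artin_group S ?m) (artin_group S' ?m')"
    and Delta: "\<And>s. s \<in> S \<Longrightarrow> Delta S' ?m' (p s) = Some (\<phi> (artin_gen S ?m s))"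
    using lcm_homomorphism_extension[OF assms(5)] unfolding lcm_homomorphism_def by simp_all
  have nonempty: "p s \<noteq> {}" and pS: "p s \<subseteq> S'" and sph: "spherical ?m' (p s)" if "s \<in> S" for s
    using lcm that unfolding lcm_condition_def by simp_all
  have "\<exists>w. \<phi> (artin_gen S ?m s) = B.artin_class S' w \<and> B.longest (p s) w" if s: "s \<in> S" for s
  proof -
    obtain y where "B.longest (p s) y" using B.spherical_imp_longest[OF sph[OF s]] by blast
    then show ?thesis using B.Delta_longest[OF Delta[OF s] pS[OF s]] by blast
  qed
  then obtain \<delta> where \<delta>: "\<And>s. s \<in> S \<Longrightarrow> \<phi> (artin_gen S ?m s) = B.artin_class S' (\<delta> s)"
    "\<And>s. s \<in> S \<Longrightarrow> B.longest (p s) (\<delta> s)"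
    by metis
  have \<delta>S: "set (\<delta> s) \<subseteq> S'" if "s \<in> S" for s
    using \<delta>(2)[OF that] pS[OF that] by (auto simp: B.longest_def)
  have D: "Delta S' ?m' (p s) = Some (B.artin_class S' (\<delta> s))" if "s \<in> S" for s
    using Delta \<delta>(1) that by simp
  have words: "set (concat (map \<delta> (alternating s t n))) \<subseteq> S'" if "s \<in> S" "t \<in> S" for s t n
    using \<delta>S that set_alternating[of s t n] by fastforce
  have prod: "alternating_prod (artin_monoid S' ?m') (B.artin_class S' (\<delta> s)) (B.artin_class S' (\<delta> t)) n
      = B.artin_class S' (concat (map \<delta> (alternating s t n)))" if "s \<in> S" "t \<in> S" for s t n
    using B.alternating_prod_class[OF \<delta>S \<delta>S] that by (simp add: map_alternating)
  have bond: "B.artin_class S' (concat (map \<delta> (alternating s t k)))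
        = B.artin_class S' (concat (map \<delta> (alternating t s k)))"
      "left_lcm (artin_monoid S' ?m') {B.artin_class S' (\<delta> s), B.artin_class S' (\<delta> t)}
        = Some (B.artin_class S' (concat (map \<delta> (alternating s t k))))"
    if st: "s \<in> S" "t \<in> S" "s \<noteq> t" "?m s t = enat k" for s t k
  proof -
    obtain d e where "Delta S' ?m' (p s) = Some d" "Delta S' ?m' (p t) = Some e"
      "alternating_prod (artin_monoid S' ?m') d e k = alternating_prod (artin_monoid S' ?m') e d k"
      "left_lcm (artin_monoid S' ?m') {d, e} = Some (alternating_prod (artin_monoid S' ?m') d e k)"
      using lcm st unfolding lcm_condition_def by blast
    then show "B.artin_class S' (concat (map \<delta> (alternating s t k)))
        = B.artin_class S' (concat (map \<delta> (alternating t s k)))"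
      "left_lcm (artin_monoid S' ?m') {B.artin_class S' (\<delta> s), B.artin_class S' (\<delta> t)}
        = Some (B.artin_class S' (concat (map \<delta> (alternating s t k))))"
      using D[OF st(1)] D[OF st(2)] prod[OF st(1,2), of k] prod[OF st(2,1), of k] by simp_all
  qed
  interpret lcm_substitution ?m ?m' S p \<delta>
  proof unfold_locales
    fix s assume "s \<in> S"
    then show "B.longest (p s) (\<delta> s)" "p s \<noteq> {}" using \<delta>(2) nonempty by auto
  next
    fix s t k assume st: "s \<in> S" "t \<in> S" "s \<noteq> t" "?m s t = enat k"
    show "B.eqv (concat (map \<delta> (alternating s t k))) (concat (map \<delta> (alternating t s k)))"
      using bond(1)[OF st] B.artin_class_eq_iff[OF words words] st(1,2) B.artin_cong_imp_eqv(1) by blast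
    show "B.reduced (concat (map \<delta> (alternating s t k)))"
      by (rule B.lcm_of_Deltas_reduced[OF \<delta>(2) pS \<delta>(2) pS D D bond(2)[OF st] words]) (use st in auto)
  next
    fix s t u y assume st: "s \<in> S" "t \<in> S" "s \<noteq> t" "?m s t = \<infinity>" "u \<in> p s"
    then have "\<not> spherical ?m' ({u} \<union> p t)" using lcm unfolding lcm_condition_def by blast
    moreover have "finite (insert u (p t))"
      using st pS assms(3) by (meson finite.insertI finite_subset)
    ultimately show "\<not> B.longest (insert u (p t)) y" using B.longest_imp_spherical by auto
  qed
  show ?thesis
    using induced_hom[OF pS \<phi> \<delta>(1)] unfolding extension_simps[OF subset_refl] .
qed

end
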